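(* Consider the continuous-time Markov process $(W(t),\xi(t))$ on $\mathcal W_p\times\{0,1\}^{\mathcal X}$ described in the context, with parameter $\gamma>0$ and arbitrary initial condition. Assume: 1. $\sum_{x\in A}\alpha_x<\sum_{y\in N(A)}\beta_y$ for every nonempty $A\subseteq\mathcal X$; 2. $\nu^{on}_x>0$, $\nu^{off}_x>0$ and $\nu^{act}_x>0$ for every $x\in\mathcal X$; 3. $\{\mathcal M_{\bar x}(W,\xi)\}$ is an admissible family. Then, as $t\to+\infty$, $W(t)$ converges in law to the probability distribution on $\mathcal W$ $$\tilde\mu_\gamma(W)=\tilde Z_\gamma^{-1}e^{\gamma\Psi(W)},\qquad W\in\mathcal W,$$ where $\tilde Z_\gamma$ is the normalizing constant. Moreover, as $\gamma\to+\infty$, $\tilde\mu_\gamma$ converges to a probability measure concentrated on the set $\operatorname{argmax}_{W\in\mathcal W}\Psi(W)$.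
   Context: **Model.** $\mathcal G=(\mathcal X,\mathcal E)$ is a finite directed graph; $N_x=\{y:(x,y)\in\mathcal E\}$, $N(D)=\bigcup_{x\in D}N_x$. $\alpha,\beta$ are vectors of nonnegative integers indexed by $\mathcal X$. A partial allocation state is a matrix $W\in\mathbb N^{\mathcal X\times\mathcal X}$ (nonnegative integer entries) with $W_{xy}=0$ if $(x,y)\notin\mathcal E$; $W^x:=\sum_yW_{xy}\le\alpha_x$ for all $x$; $W_y:=\sum_xW_{xy}\le\beta_y$ for all $y$. $\mathcal W_p$ is the set of these, and $\mathcal W=\{W\in\mathcal W_p: W^x=\alpha_x\ \forall x\}$ is the set of allocation states. $\|W\|=\sum_{x,y}W_{xy}$. **Admissible families.** A functional state is $\xi\in\{0,1\}^{\mathcal X}$. $e_{xy}$ is the matrix with $1$ in position $(x,y)$ and $0$ elsewhere. For $W\in\mathcal W_p$, $\xi$, and $\bar x$ with $\xi_{\bar x}=1$, let $$\mathcal W_{\bar x}(W,\xi)=\{W'\in\mathcal W_p: W'\ne W,\ W'^{\bar x}\ge W^{\bar x},\ W'_{xy}=W_{xy}\text{ whenever }x\ne\bar x\text{ or }\xi_y=0\},$$ $$N_{\bar x}(W,\xi)=\{y\in N_{\bar x}: W_y<\beta_y,\ \xi_y=1\}.$$ A family of subsets $\mathcal M_{\bar x}(W,\xi)\subseteq\mathcal W_{\bar x}(W,\xi)$ (for all $W\in\mathcal W_p$, $\xi$, and $\bar x$ with $\xi_{\bar x}=1$) is admissible if: (i) if $W^{\bar x}<\alpha_{\bar x}$ and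 $y\in N_{\bar x}(W,\xi)$, then there is an integer $n\ge1$ with $W+n e_{\bar xy}\in\mathcal M_{\bar x}(W,\xi)$; (ii) if $W_{\bar xy'}>0$, $\xi_{y'}=1$, $y''\in N_{\bar x}(W,\xi)$ and $y''\neq y'$, then $W+e_{\bar xy''}-e_{\bar xy'}\in\mathcal M_{\bar x}(W,\xi)$; (iii) for all $W,W'\in\mathcal W$: $W'\in\mathcal M_{\bar x}(W,\xi)$ iff $W\in\mathcal M_{\bar x}(W',\xi)$. **Potential and utilities.** $\Psi:\mathcal W_p\to\mathbb R$ has the form $\Psi(W)=\sum_xf_x(W_{x\cdot})+\sum_yg_y(W_{\cdot y})$, with $f_x,g_y$ real-valued functions of the $x$-th row and $y$-th column of $W$. The utilities $U_x:\mathcal W_p\to\mathbb R$ satisfy $U_{\bar x}(W')-U_{\bar x}(W)=\Psi(W')-\Psi(W)$ whenever $W,W'\in\mathcal W_p$ agree outside row $\bar x$ (for instance $U_x(W)=f_x(W_{x\cdot})+\sum_{y\in N_x}g_y(W_{\cdot y})$). **Process.** Fix $\gamma>0$ and rates $\nu_x^{on},\nu_x^{off},\nu_x^{act}\ge0$. Let $Z^{(W,\xi)}_{\bar x}=\sum_{\tilde W\in\mathcal M_{\bar x}(W,\xi)}e^{\gamma U_{\bar x}(\tilde W)}$ and $Z^{(W,W',\xi)}_{\bar x}=\max\{Z^{(W,\xi)}_{\bar x},Z^{(W',\xi)}_{\bar x}\}$. For $W'\in\mathcal M_{\bar x}(W,\xi)$ set $P^{(W,\xi)}_{\bar x}(W')=e^{\gamma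 U_{\bar x}(W')}/Z^{(W,\xi)}_{\bar x}$ if $\|W\|<\|W'\|$, and $P^{(W,\xi)}_{\bar x}(W')=e^{\gamma U_{\bar x}(W')}/Z^{(W,W',\xi)}_{\bar x}$ if $\|W\|=\|W'\|$ (the remaining probability is assigned to staying at $W$). $(W(t),\xi(t))$ is the continuous-time Markov chain on $\mathcal W_p\times\{0,1\}^{\mathcal X}$ whose only nonzero transition rates between distinct states are: from $(W,\xi)$ to $(W,\xi')$, where $\xi'$ differs from $\xi$ only at $\bar x$: rate $\nu^{on}_{\bar x}$ if $\xi_{\bar x}=0,\xi'_{\bar x}=1$, and rate $\nu^{off}_{\bar x}$ if $\xi_{\bar x}=1,\xi'_{\bar x}=0$; from $(W,\xi)$ to $(W',\xi)$, where $\xi_{\bar x}=1$ and $W'\in\mathcal M_{\bar x}(W,\xi)$: rate $\nu^{act}_{\bar x}P^{(W,\xi)}_{\bar x}(W')$. *)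

theory Defs
  imports "HOL-Probability.Probability"
begin

section \<open>Allocations\<close>

text \<open>The vertex set of the finite directed graph is the finite type \<open>'x\<close>; the edge set is an
  arbitrary set \<open>E\<close> of ordered pairs.\<close>

type_synonym 'x alloc = "'x \<Rightarrow> 'x \<Rightarrow> nat"

definition nbrs :: "('x \<times> 'x) set \<Rightarrow> 'x \<Rightarrow> 'x set" where
  "nbrs E x = {y. (x, y) \<in> E}"

definition row_sum :: "('x::finite) alloc \<Rightarrow> 'x \<Rightarrow> nat" where
  "row_sum W x = (\<Sum>y\<in>UNIV. W x y)"

definition col_sum :: "('x::finite) alloc \<Rightarrow> 'x \<Rightarrow> nat" where
  "col_sum W y = (\<Sum>x\<in>UNIV. W x y)"

definition total :: "('x::finite) alloc \<Rightarrow> nat" where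
  "total W = (\<Sum>x\<in>UNIV. \<Sum>y\<in>UNIV. W x y)"

definition partial_allocs ::
  "('x::finite \<times> 'x) set \<Rightarrow> ('x \<Rightarrow> nat) \<Rightarrow> ('x \<Rightarrow> nat) \<Rightarrow> 'x alloc set" where
  "partial_allocs E \<alpha> \<beta> =
     {W. (\<forall>x y. (x, y) \<notin> E \<longrightarrow> W x y = 0) \<and>
         (\<forall>x. row_sum W x \<le> \<alpha> x) \<and> (\<forall>y. col_sum W y \<le> \<beta> y)}"

definition allocs ::
  "('x::finite \<times> 'x) set \<Rightarrow> ('x \<Rightarrow> nat) \<Rightarrow> ('x \<Rightarrow> nat) \<Rightarrow> 'x alloc set" where
  "allocs E \<alpha> \<beta> = {W \<in> partial_allocs E \<alpha> \<beta>. \<forall>x. row_sum W x = \<alpha> x}"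

section \<open>Admissible families\<close>

definition unit_mat :: "'x \<Rightarrow> 'x \<Rightarrow> 'x alloc" where
  "unit_mat x y = (\<lambda>a b. if a = x \<and> b = y then 1 else 0)"

definition row_moves ::
  "('x::finite \<times> 'x) set \<Rightarrow> ('x \<Rightarrow> nat) \<Rightarrow> ('x \<Rightarrow> nat) \<Rightarrow> 'x \<Rightarrow> 'x alloc \<Rightarrow> ('x \<Rightarrow> bool) \<Rightarrow> 'x alloc set"
where
  "row_moves E \<alpha> \<beta> z W \<xi> =
     {W' \<in> partial_allocs E \<alpha> \<beta>. W' \<noteq> W \<and> row_sum W' z \<ge> row_sum W z \<and>
        (\<forall>x y. x \<noteq> z \<or> \<not> \<xi> y \<longrightarrow> W' x y = W x y)}"

definition avail_nbrs ::
  "('x::finite \<times> 'x) set \<Rightarrow> ('x \<Rightarrow> nat) \<Rightarrow> 'x \<Rightarrow> 'x alloc \<Rightarrow> ('x \<Rightarrow> bool) \<Rightarrow> 'x set" where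
  "avail_nbrs E \<beta> z W \<xi> = {y \<in> nbrs E z. col_sum W y < \<beta> y \<and> \<xi> y}"

text \<open>In the third clause the truncated subtraction is exact, because \<open>W z y' > 0\<close>.\<close>

definition admissible ::
  "('x::finite \<times> 'x) set \<Rightarrow> ('x \<Rightarrow> nat) \<Rightarrow> ('x \<Rightarrow> nat) \<Rightarrow>
   ('x \<Rightarrow> 'x alloc \<Rightarrow> ('x \<Rightarrow> bool) \<Rightarrow> 'x alloc set) \<Rightarrow> bool" where
  "admissible E \<alpha> \<beta> \<M> \<longleftrightarrow>
     (\<forall>z \<xi>. \<forall>W \<in> partial_allocs E \<alpha> \<beta>. \<xi> z \<longrightarrow>
        \<M> z W \<xi> \<subseteq> row_moves E \<alpha> \<beta> z W \<xi>) \<and>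
     (\<forall>z \<xi>. \<forall>W \<in> partial_allocs E \<alpha> \<beta>. \<forall>y. \<xi> z \<longrightarrow>
        row_sum W z < \<alpha> z \<longrightarrow> y \<in> avail_nbrs E \<beta> z W \<xi> \<longrightarrow>
        (\<exists>n\<ge>1. (\<lambda>a b. W a b + n * unit_mat z y a b) \<in> \<M> z W \<xi>)) \<and>
     (\<forall>z \<xi>. \<forall>W \<in> partial_allocs E \<alpha> \<beta>. \<forall>y' y''. \<xi> z \<longrightarrow>
        W z y' > 0 \<longrightarrow> \<xi> y' \<longrightarrow> y'' \<in> avail_nbrs E \<beta> z W \<xi> \<longrightarrow> y'' \<noteq> y' \<longrightarrow>
        (\<lambda>a b. W a b + unit_mat z y'' a b - unit_mat z y' a b) \<in> \<M> z W \<xi>) \<and>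
     (\<forall>z \<xi>. \<forall>W \<in> allocs E \<alpha> \<beta>. \<forall>W' \<in> allocs E \<alpha> \<beta>. \<xi> z \<longrightarrow>
        (W' \<in> \<M> z W \<xi> \<longleftrightarrow> W \<in> \<M> z W' \<xi>))"

section \<open>Potential and utilities\<close>

definition potential ::
  "('x::finite \<Rightarrow> ('x \<Rightarrow> nat) \<Rightarrow> real) \<Rightarrow> ('x \<Rightarrow> ('x \<Rightarrow> nat) \<Rightarrow> real) \<Rightarrow> 'x alloc \<Rightarrow> real" where
  "potential f g W = (\<Sum>x\<in>UNIV. f x (\<lambda>y. W x y)) + (\<Sum>y\<in>UNIV. g y (\<lambda>x. W x y))"

definition utilities_of_potential ::
  "'x alloc set \<Rightarrow> ('x alloc \<Rightarrow> real) \<Rightarrow> ('x \<Rightarrow> 'x alloc \<Rightarrow> real) \<Rightarrow> bool" where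
  "utilities_of_potential Wp \<Psi> U \<longleftrightarrow>
     (\<forall>z. \<forall>W \<in> Wp. \<forall>W' \<in> Wp. (\<forall>x y. x \<noteq> z \<longrightarrow> W' x y = W x y) \<longrightarrow>
        U z W' - U z W = \<Psi> W' - \<Psi> W)"

section \<open>Transition rates\<close>

definition part_fun ::
  "real \<Rightarrow> ('x \<Rightarrow> 'x alloc \<Rightarrow> real) \<Rightarrow> ('x \<Rightarrow> 'x alloc \<Rightarrow> ('x \<Rightarrow> bool) \<Rightarrow> 'x alloc set) \<Rightarrow>
   'x \<Rightarrow> 'x alloc \<Rightarrow> ('x \<Rightarrow> bool) \<Rightarrow> real" where
  "part_fun \<gamma> U \<M> z W \<xi> = (\<Sum>W' \<in> \<M> z W \<xi>. exp (\<gamma> * U z W'))"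

text \<open>For an admissible family the last alternative never arises on \<open>W' \<in> \<M> z W \<xi>\<close>.\<close>

definition move_prob ::
  "real \<Rightarrow> ('x::finite \<Rightarrow> 'x alloc \<Rightarrow> real) \<Rightarrow>
   ('x \<Rightarrow> 'x alloc \<Rightarrow> ('x \<Rightarrow> bool) \<Rightarrow> 'x alloc set) \<Rightarrow>
   'x \<Rightarrow> 'x alloc \<Rightarrow> ('x \<Rightarrow> bool) \<Rightarrow> 'x alloc \<Rightarrow> real" where
  "move_prob \<gamma> U \<M> z W \<xi> W' =
     (if total W < total W' then exp (\<gamma> * U z W') / part_fun \<gamma> U \<M> z W \<xi>
      else if total W = total W' then
        exp (\<gamma> * U z W') / max (part_fun \<gamma> U \<M> z W \<xi>) (part_fun \<gamma> U \<M> z W' \<xi>)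
      else 0)"

text \<open>At most one summand below is nonzero: the vertex \<open>z\<close> is determined by the two states, as
  members of \<open>\<M> z W \<xi>\<close> differ from \<open>W\<close> in row \<open>z\<close> and only there.\<close>

definition alloc_rate ::
  "real \<Rightarrow> ('x::finite \<Rightarrow> real) \<Rightarrow> ('x \<Rightarrow> real) \<Rightarrow> ('x \<Rightarrow> real) \<Rightarrow> ('x \<Rightarrow> 'x alloc \<Rightarrow> real) \<Rightarrow>
   ('x \<Rightarrow> 'x alloc \<Rightarrow> ('x \<Rightarrow> bool) \<Rightarrow> 'x alloc set) \<Rightarrow>
   'x alloc \<times> ('x \<Rightarrow> bool) \<Rightarrow> 'x alloc \<times> ('x \<Rightarrow> bool) \<Rightarrow> real" where
  "alloc_rate \<gamma> \<nu>on \<nu>off \<nu>act U \<M> = (\<lambda>(W, \<xi>) (W', \<xi>'). \<Sum>z\<in>UNIV.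
     (if W' = W \<and> \<not> \<xi> z \<and> \<xi>' = \<xi>(z := True) then \<nu>on z else 0) +
     (if W' = W \<and> \<xi> z \<and> \<xi>' = \<xi>(z := False) then \<nu>off z else 0) +
     (if \<xi>' = \<xi> \<and> \<xi> z \<and> W' \<in> \<M> z W \<xi> then \<nu>act z * move_prob \<gamma> U \<M> z W \<xi> W' else 0))"

section \<open>Continuous-time Markov chains on a finite state space\<close>

text \<open>Standard transition functions on \<open>S\<close> with transition rates \<open>q i j\<close> for \<open>i \<noteq> j\<close>, that is
  \<open>p h i j = q i j * h + o(h)\<close>; diagonal values of \<open>q\<close> are ignored. As \<open>S\<close> is finite and rows sum
  to \<open>1\<close>, this determines \<open>p t\<close> as the exponential of \<open>t\<close> times the generator.\<close>

definition transition_function ::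
  "'s set \<Rightarrow> ('s \<Rightarrow> 's \<Rightarrow> real) \<Rightarrow> (real \<Rightarrow> 's \<Rightarrow> 's \<Rightarrow> real) \<Rightarrow> bool" where
  "transition_function S q p \<longleftrightarrow>
     finite S \<and>
     (\<forall>t\<ge>0. \<forall>i\<in>S. \<forall>j\<in>S. 0 \<le> p t i j) \<and>
     (\<forall>t\<ge>0. \<forall>i\<in>S. (\<Sum>j\<in>S. p t i j) = 1) \<and>
     (\<forall>i\<in>S. \<forall>j\<in>S. p 0 i j = (if i = j then 1 else 0)) \<and>
     (\<forall>s\<ge>0. \<forall>t\<ge>0. \<forall>i\<in>S. \<forall>j\<in>S. p (s + t) i j = (\<Sum>k\<in>S. p s i k * p t k j)) \<and>
     (\<forall>i\<in>S. \<forall>j\<in>S. i \<noteq> j \<longrightarrow> ((\<lambda>h. p h i j / h) \<longlongrightarrow> q i j) (at_right 0))"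

text \<open>The law of the initial state is unconstrained, and no path regularity is required.\<close>

definition ctmc ::
  "'w measure \<Rightarrow> 's set \<Rightarrow> ('s \<Rightarrow> 's \<Rightarrow> real) \<Rightarrow> (real \<Rightarrow> 'w \<Rightarrow> 's) \<Rightarrow> bool" where
  "ctmc \<Omega> S q X \<longleftrightarrow>
     prob_space \<Omega> \<and>
     (\<forall>t\<ge>0. X t \<in> measurable \<Omega> (count_space S)) \<and>
     (\<exists>p. transition_function S q p \<and>
        (\<forall>(n::nat) (\<tau> :: nat \<Rightarrow> real) s.
           0 \<le> \<tau> 0 \<longrightarrow> (\<forall>i\<le>n. \<tau> i < \<tau> (Suc i)) \<longrightarrow> (\<forall>i\<le>Suc n. s i \<in> S) \<longrightarrow>
           \<P>(\<omega> in \<Omega>. \<forall>i\<le>n. X (\<tau> i) \<omega> = s i) > 0 \<longrightarrow>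
           \<P>(\<omega> in \<Omega>. X (\<tau> (Suc n)) \<omega> = s (Suc n) \<bar> \<forall>i\<le>n. X (\<tau> i) \<omega> = s i)
             = p (\<tau> (Suc n) - \<tau> n) (s n) (s (Suc n))))"

section \<open>Convergence in law and the limit distribution\<close>

text \<open>Weak convergence of measures on a discrete space (\<open>\<sigma>\<close>-algebra of all subsets), where every
  bounded function is a bounded continuous test function.\<close>

definition weak_conv_discrete ::
  "('i \<Rightarrow> 'a measure) \<Rightarrow> 'a measure \<Rightarrow> 'i filter \<Rightarrow> bool" where
  "weak_conv_discrete \<mu> \<nu> F \<longleftrightarrow>
     (\<forall>f :: 'a \<Rightarrow> real. bounded (range f) \<longrightarrow>
        ((\<lambda>i. \<integral>x. f x \<partial>\<mu> i) \<longlongrightarrow> (\<integral>x. f x \<partial>\<nu>)) F)"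

definition gibbs :: "'a set \<Rightarrow> ('a \<Rightarrow> real) \<Rightarrow> real \<Rightarrow> 'a measure" where
  "gibbs A \<Psi> \<gamma> = density (count_space UNIV)
     (\<lambda>a. ennreal (if a \<in> A then exp (\<gamma> * \<Psi> a) / (\<Sum>b\<in>A. exp (\<gamma> * \<Psi> b)) else 0))"

end

theory Submission
  imports Defs
begin

text \<open>The measure proportional to \<open>exp (\<gamma> \<Psi> W)\<close> times the product of the switching rates satisfies
  detailed balance: on full allocations the moves are symmetric and their normalization is the same
  in both directions, and full allocations are never left. With all vertices on, alternating paths
  that end in a free column exist by the strict Hall condition; they lead from every state to a full
  allocation and connect all full allocations. So some state is reachable from everywhere, and the
  Doeblin contraction of the semigroup gives convergence.\<close>

section \<open>Ergodicity of finite continuous-time chains\<close>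

text \<open>Full allocations are reached from every state and never left, so no stationary law
  charges the other states. Giving them weight zero makes detailed balance trivial there, but
  convergence must then do without irreducibility. One state reachable from everywhere is enough,
  and no periodicity can interfere, since return probabilities are positive at all times. The
  combinatorial obstacle is that only additions and single-unit shifts into a column below capacity
  are guaranteed, whereas two full allocations may differ only in columns saturated in both. Slack
  must then be brought from elsewhere. It exists because a set of saturated columns closed under
  alternating paths contains exactly the units of the rows \<open>A\<close> whose neighbours all lie
  in it; its capacity, at least that of the neighbourhood of \<open>A\<close>, would be at most the
  sum of \<alpha> over \<open>A\<close>, against the strict inequality. Switching everything on
  removes the functional state from this argument.\<close>

context
  fixes S :: "'s set" and q :: "'s \<Rightarrow> 's \<Rightarrow> real" and p :: "real \<Rightarrow> 's \<Rightarrow> 's \<Rightarrow> real"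
  assumes tf: "transition_function S q p"
begin

lemma finite_states: "finite S"
  and transition_nonneg: "\<And>t i j. 0 \<le> t \<Longrightarrow> i \<in> S \<Longrightarrow> j \<in> S \<Longrightarrow> 0 \<le> p t i j"
  and transition_row_sum: "\<And>t i. 0 \<le> t \<Longrightarrow> i \<in> S \<Longrightarrow> (\<Sum>j\<in>S. p t i j) = 1"
  and transition_zero: "\<And>i j. i \<in> S \<Longrightarrow> j \<in> S \<Longrightarrow> p 0 i j = (if i = j then 1 else 0)"
  and transition_add: "\<And>s t i j. 0 \<le> s \<Longrightarrow> 0 \<le> t \<Longrightarrow> i \<in> S \<Longrightarrow> j \<in> S \<Longrightarrow>
        p (s + t) i j = (\<Sum>k\<in>S. p s i k * p t k j)"
  and transition_rate: "\<And>i j. i \<in> S \<Longrightarrow> j \<in> S \<Longrightarrow> i \<noteq> j \<Longrightarrow>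
        ((\<lambda>h. p h i j / h) \<longlongrightarrow> q i j) (at_right 0)"
  using tf by (simp_all add: transition_function_def)

lemma transition_le_1:
  assumes "0 \<le> t" "i \<in> S" "j \<in> S"
  shows "p t i j \<le> 1"
  using member_le_sum[of j S "p t i"] transition_row_sum[of t i] finite_states
    transition_nonneg assms by auto

lemma transition_mult_le:
  assumes "0 \<le> s" "0 \<le> t" "i \<in> S" "k \<in> S" "j \<in> S"
  shows "p s i k * p t k j \<le> p (s + t) i j"
proof -
  have "p s i k * p t k j \<le> (\<Sum>k\<in>S. p s i k * p t k j)"
    using assms finite_states transition_nonneg
    by (intro member_le_sum[of k S "\<lambda>k. p s i k * p t k j"]) auto
  then show ?thesis using transition_add assms by simp
qed

text \<open>Rates are prescribed off the diagonal only; since rows sum to 1, the diagonal quotient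
  is minus the finite sum of the others.\<close>

lemma generator_diag:
  assumes i: "i \<in> S"
  shows "((\<lambda>h. (p h i i - 1) / h) \<longlongrightarrow> - (\<Sum>k\<in>S - {i}. q i k)) (at_right 0)"
proof (rule Lim_transform_eventually)
  show "((\<lambda>h. - (\<Sum>k\<in>S - {i}. p h i k / h)) \<longlongrightarrow> - (\<Sum>k\<in>S - {i}. q i k)) (at_right 0)"
    by (intro tendsto_minus tendsto_sum) (use i transition_rate in auto)
  have "- (\<Sum>k\<in>S - {i}. p h i k / h) = (p h i i - 1) / h" if "0 < h" for h
  proof -
    have "(\<Sum>k\<in>S. p h i k) = p h i i + (\<Sum>k\<in>S - {i}. p h i k)"
      using finite_states i by (simp add: sum.remove)
    then have "- (\<Sum>k\<in>S - {i}. p h i k) = p h i i - 1"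
      using transition_row_sum[of h i] that i by simp
    then show ?thesis by (metis sum_divide_distrib minus_divide_left)
  qed
  then show "\<forall>\<^sub>F h in at_right 0. - (\<Sum>k\<in>S - {i}. p h i k / h) = (p h i i - 1) / h"
    by (auto simp: eventually_at_filter)
qed

text \<open>For short times \<open>p h i i\<close> is close to 1; a long time is cut into equal
  short steps, and staying at \<open>i\<close> at the end of each has positive probability. This
  lets the chain wait at a state.\<close>

lemma transition_diag_pos:
  assumes t: "0 \<le> t" and i: "i \<in> S"
  shows "0 < p t i i"
proof -
  \<comment> \<open>For h > 0 the expression is \<open>p h i i\<close>; in this shape its limit 1
    follows from the generator limit, and continuity at 0 need not be assumed.\<close>
  have "((\<lambda>h. h * ((p h i i - 1) / h) + 1) \<longlongrightarrow> 0 * - (\<Sum>k\<in>S - {i}. q i k) + 1) (at_right 0)"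
    by (intro tendsto_intros generator_diag i)
  then have "\<forall>\<^sub>F h in at_right 0. 0 < h * ((p h i i - 1) / h) + 1"
    by (rule order_tendstoD) simp
  then obtain b where b: "b > 0" "\<And>h. 0 < h \<Longrightarrow> h < b \<Longrightarrow> 0 < h * ((p h i i - 1) / h) + 1"
    by (auto simp: eventually_at_right_field)
  have small: "0 < p h i i" if "0 < h" "h < b" for h
    using b(2)[OF that] that by simp
  have mult: "0 < p (real n * h) i i" if "0 < h" "h < b" for n h
  proof (induction n)
    case 0
    then show ?case using transition_zero i by simp
  next
    case (Suc n)
    have "0 < p (real n * h) i i * p h i i" using Suc small that by simp
    also have "\<dots> \<le> p (real n * h + h) i i" using that i by (intro transition_mult_le) auto
    finally show ?case by (simp add: algebra_simps)
  qed
  obtain n where n: "t < real n * b" using reals_Archimedean3[OF b(1)] by blast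
  have "n > 0" using n t by (cases n) auto
  show ?thesis
  proof (cases "t = 0")
    case True
    then show ?thesis using transition_zero i by simp
  next
    case False
    then have "0 < p (real n * (t / real n)) i i"
      using t n \<open>n > 0\<close> by (intro mult) (auto simp: field_simps)
    then show ?thesis using \<open>n > 0\<close> by simp
  qed
qed

text \<open>A jump of positive rate is made with positive probability within some short time, and
  the times along a path add up. The resulting time depends on \<open>i\<close>.\<close>

lemma transition_pos_of_reachable:
  assumes "(i, j) \<in> {(a, b). a \<in> S \<and> b \<in> S \<and> a \<noteq> b \<and> q a b > 0}\<^sup>*" and "i \<in> S"
  shows "\<exists>t\<ge>0. p t i j > 0"
proof -
  have "j \<in> S \<and> (\<exists>t\<ge>0. p t i j > 0)"
    using assms(1)
  proof (induction rule: rtrancl_induct)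
    case base
    then show ?case using transition_zero assms(2) by (auto intro!: exI[of _ 0])
  next
    case (step j k)
    then obtain t where t: "t \<ge> 0" "p t i j > 0" and jk: "j \<in> S" "k \<in> S" "j \<noteq> k" "q j k > 0"
      by auto
    have "\<forall>\<^sub>F h in at_right 0. 0 < p h j k / h"
      using order_tendstoD(1)[OF transition_rate] jk by blast
    then have "\<forall>\<^sub>F h in at_right 0. 0 < p h j k / h \<and> 0 < h"
      by (intro eventually_conj) (auto simp: eventually_at_filter)
    then obtain h where "0 < p h j k / h" "0 < h"
      using eventually_happens trivial_limit_at_right_real by blast
    then have h: "0 < h" "0 < p h j k" by (auto simp: zero_less_divide_iff)
    have "0 < p t i j * p h j k" using t h by simp
    also have "\<dots> \<le> p (t + h) i k" using t h jk assms(2) by (intro transition_mult_le) auto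
    finally show ?case using t h jk by (auto intro!: exI[of _ "t + h"])
  qed
  then show ?thesis by blast
qed

text \<open>No differentiability of the semigroup is needed: over a step of length \<open>t / n\<close> the
  quantity \<open>\<Sum>i. \<pi> i * p s i j\<close> changes by \<open>o(t / n)\<close>, uniformly in \<open>s\<close>.\<close>

lemma detailed_balance_stationary:
  fixes \<pi> :: "'s \<Rightarrow> real"
  assumes db: "\<And>i j. i \<in> S \<Longrightarrow> j \<in> S \<Longrightarrow> i \<noteq> j \<Longrightarrow> \<pi> i * q i j = \<pi> j * q j i"
    and t: "0 \<le> t" and j: "j \<in> S"
  shows "(\<Sum>i\<in>S. \<pi> i * p t i j) = \<pi> j"
proof -
  define err where "err h k = (\<Sum>i\<in>S. \<pi> i * p h i k) - \<pi> k" for h k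
  define e where "e h = (\<Sum>k\<in>S. \<bar>err h k\<bar>)" for h
  have err_lim: "((\<lambda>h. err h k / h) \<longlongrightarrow> 0) (at_right 0)" if k: "k \<in> S" for k
  proof -
    have "((\<lambda>h. \<pi> k * ((p h k k - 1) / h) + (\<Sum>i\<in>S - {k}. \<pi> i * (p h i k / h))) \<longlongrightarrow>
        \<pi> k * (- (\<Sum>i\<in>S - {k}. q k i)) + (\<Sum>i\<in>S - {k}. \<pi> i * q i k)) (at_right 0)"
    proof (intro tendsto_add tendsto_mult tendsto_const tendsto_sum)
      show "((\<lambda>h. (p h k k - 1) / h) \<longlongrightarrow> - (\<Sum>i\<in>S - {k}. q k i)) (at_right 0)"
        using k by (rule generator_diag)
      show "((\<lambda>h. p h i k / h) \<longlongrightarrow> q i k) (at_right 0)" if "i \<in> S - {k}" for i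
        using that k by (intro transition_rate) auto
    qed
    \<comment> \<open>Detailed balance enters only here: inflow into \<open>k\<close> equals
      outflow, so \<open>err\<close> has derivative zero at 0.\<close>
    moreover have "(\<Sum>i\<in>S - {k}. \<pi> i * q i k) = \<pi> k * (\<Sum>i\<in>S - {k}. q k i)"
      unfolding sum_distrib_left by (intro sum.cong) (use db k in auto)
    moreover have "\<pi> k * ((p h k k - 1) / h) + (\<Sum>i\<in>S - {k}. \<pi> i * (p h i k / h)) = err h k / h"
      for h
    proof -
      have "(\<Sum>i\<in>S. \<pi> i * p h i k) = \<pi> k * p h k k + (\<Sum>i\<in>S - {k}. \<pi> i * p h i k)"
        using finite_states k by (simp add: sum.remove)
      then show ?thesis
        by (simp add: err_def sum_divide_distrib diff_divide_distrib add_divide_distrib algebra_simps)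
    qed
    ultimately show ?thesis by simp
  qed
  have e_lim: "((\<lambda>h. e h / h) \<longlongrightarrow> 0) (at_right 0)"
  proof (rule Lim_transform_eventually)
    have "((\<lambda>h. \<Sum>k\<in>S. \<bar>err h k / h\<bar>) \<longlongrightarrow> (\<Sum>k\<in>S. \<bar>0\<bar>)) (at_right 0)"
      by (intro tendsto_sum tendsto_rabs err_lim)
    then show "((\<lambda>h. \<Sum>k\<in>S. \<bar>err h k / h\<bar>) \<longlongrightarrow> 0) (at_right 0)" by simp
    show "\<forall>\<^sub>F h in at_right 0. (\<Sum>k\<in>S. \<bar>err h k / h\<bar>) = e h / h"
      by (auto simp: eventually_at_filter e_def sum_divide_distrib)
  qed
  define v where "v s = (\<Sum>i\<in>S. \<pi> i * p s i j)" for s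
  \<comment> \<open>The short step comes first in the Chapman-Kolmogorov split, so the error is made
    by \<open>\<pi>\<close> itself and then only averaged by \<open>p s k j\<close>, which is at
    most 1. Hence the bound does not depend on \<open>s\<close>.\<close>
  have step: "\<bar>v (h + s) - v s\<bar> \<le> e h" if "0 \<le> h" "0 \<le> s" for h s
  proof -
    have "v (h + s) = (\<Sum>i\<in>S. \<Sum>k\<in>S. \<pi> i * (p h i k * p s k j))"
      unfolding v_def using that j by (simp add: transition_add sum_distrib_left)
    also have "\<dots> = (\<Sum>k\<in>S. (\<Sum>i\<in>S. \<pi> i * p h i k) * p s k j)"
      by (subst sum.swap) (simp add: sum_distrib_right mult.assoc)
    finally have "v (h + s) - v s = (\<Sum>k\<in>S. err h k * p s k j)"
      by (simp add: v_def err_def left_diff_distrib sum_subtractf)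
    also have "\<bar>\<dots>\<bar> \<le> (\<Sum>k\<in>S. \<bar>err h k * p s k j\<bar>)" by (rule sum_abs)
    also have "\<dots> \<le> e h"
      unfolding e_def abs_mult using that j transition_le_1 transition_nonneg
      by (intro sum_mono mult_left_le) auto
    finally show ?thesis .
  qed
  have v0: "v 0 = \<pi> j"
    using j finite_states by (simp add: v_def transition_zero if_distrib cong: if_cong)
  have steps: "\<bar>v (real n * h) - v 0\<bar> \<le> real n * e h" if "0 \<le> h" for n h
  proof (induction n)
    case (Suc n)
    have "\<bar>v (h + real n * h) - v (real n * h)\<bar> \<le> e h" using that by (intro step) auto
    with Suc show ?case by (simp add: algebra_simps)
  qed simp
  have "v t = v 0"
  proof (cases "t = 0")
    case False
    with t have "t > 0" by simp
    \<comment> \<open>The \<open>n\<close> steps of length \<open>h = t / n\<close> cost at most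
      \<open>n * e h = t * (e h / h)\<close>, which tends to 0.\<close>
    have "filterlim (\<lambda>n. t / real n) (at_right 0) sequentially"
      using \<open>t > 0\<close> by real_asymp
    then have "(\<lambda>n. t * (e (t / real n) / (t / real n))) \<longlonglongrightarrow> t * 0"
      by (intro tendsto_mult tendsto_const) (rule filterlim_compose[OF e_lim])
    moreover have "\<forall>\<^sub>F n in sequentially. \<bar>v t - v 0\<bar> \<le> t * (e (t / real n) / (t / real n))"
      using eventually_gt_at_top[of 0]
    proof eventually_elim
      case (elim n)
      then show ?case using steps[of "t / real n" n] \<open>t > 0\<close> by (simp add: mult.commute)
    qed
    ultimately have "\<bar>v t - v 0\<bar> \<le> t * 0"
      by (rule tendsto_lowerbound) simp
    then show ?thesis by simp
  qed simp
  then show ?thesis using v0 by (simp add: v_def)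
qed

text \<open>At a common time \<open>t0\<close> every row puts mass at least \<open>\<delta>\<close>
  on \<open>c\<close>. The difference between the current law and \<open>\<pi>\<close> therefore
  shrinks in the l1 norm by the factor \<open>1 - \<delta>\<close> over each period
  \<open>t0\<close>.\<close>

theorem transition_function_converges:
  fixes \<pi> :: "'s \<Rightarrow> real"
  assumes db: "\<And>i j. i \<in> S \<Longrightarrow> j \<in> S \<Longrightarrow> i \<noteq> j \<Longrightarrow> \<pi> i * q i j = \<pi> j * q j i"
    and sum1: "(\<Sum>i\<in>S. \<pi> i) = 1"
    and c: "c \<in> S"
    and reach: "\<And>i. i \<in> S \<Longrightarrow> (i, c) \<in> {(a, b). a \<in> S \<and> b \<in> S \<and> a \<noteq> b \<and> q a b > 0}\<^sup>*"
    and i: "i \<in> S" and j: "j \<in> S"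
  shows "((\<lambda>t. p t i j) \<longlongrightarrow> \<pi> j) at_top"
proof -
  have "\<forall>k\<in>S. \<exists>t\<ge>0. p t k c > 0"
    by (intro ballI transition_pos_of_reachable reach)
  then obtain T where T: "\<And>k. k \<in> S \<Longrightarrow> T k \<ge> 0 \<and> p (T k) k c > 0"
    unfolding bchoice_iff by blast
  \<comment> \<open>\<open>t0\<close> exceeds every hitting time \<open>T k\<close>, so one time
    serves all starting points: after reaching \<open>c\<close> at \<open>T k\<close> the chain is
    at \<open>c\<close> again at \<open>t0\<close> with positive probability.\<close>
  define t0 where "t0 = 1 + (\<Sum>k\<in>S. T k)"
  have t0: "t0 > 0" using T by (auto simp: t0_def intro!: add_pos_nonneg sum_nonneg)
  have pos: "p t0 k c > 0" if k: "k \<in> S" for k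
  proof -
    have "T k \<le> (\<Sum>k\<in>S. T k)" using T finite_states k by (intro member_le_sum) auto
    then have le: "T k \<le> t0" by (simp add: t0_def)
    then have "0 < p (T k) k c * p (t0 - T k) c c"
      using T[OF k] transition_diag_pos[of "t0 - T k" c] c by simp
    also have "\<dots> \<le> p (T k + (t0 - T k)) k c"
      using T[OF k] le k c by (intro transition_mult_le) auto
    finally show ?thesis by simp
  qed
  define \<delta> where "\<delta> = Min ((\<lambda>k. p t0 k c) ` S)"
  have "\<delta> \<in> (\<lambda>k. p t0 k c) ` S"
    unfolding \<delta>_def using finite_states c by (intro Min_in) auto
  then have \<delta>: "\<delta> > 0" "\<And>k. k \<in> S \<Longrightarrow> \<delta> \<le> p t0 k c"
    using pos finite_states by (auto simp: \<delta>_def)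
  have \<delta>1: "\<delta> \<le> 1" using \<delta>(2)[OF c] transition_le_1[of t0 c c] t0 c by simp
  define r where "r k l = p t0 k l - (if l = c then \<delta> else 0)" for k l
  have r_nonneg: "r k l \<ge> 0" if "k \<in> S" "l \<in> S" for k l
    using that \<delta> transition_nonneg[of t0 k l] t0 by (auto simp: r_def)
  have r_sum: "(\<Sum>l\<in>S. r k l) = 1 - \<delta>" if "k \<in> S" for k
    using that transition_row_sum[of t0 k] t0 c finite_states by (simp add: r_def sum_subtractf)
  define d where "d t k = p t i k - \<pi> k" for t k
  define D where "D t = (\<Sum>k\<in>S. \<bar>d t k\<bar>)" for t
  have d_sum: "(\<Sum>k\<in>S. d t k) = 0" if "t \<ge> 0" for t
    using that transition_row_sum i sum1 by (simp add: d_def sum_subtractf)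
  have d_step: "d (t + s) l = (\<Sum>k\<in>S. d t k * p s k l)" if "t \<ge> 0" "s \<ge> 0" "l \<in> S" for t s l
    using that transition_add[of t s i l] detailed_balance_stationary[OF db, of s l] i
    by (simp add: d_def left_diff_distrib sum_subtractf)
  \<comment> \<open>One estimate, two kernels: \<open>p s\<close> with row sums 1 shows that
    \<open>D\<close> never increases, which covers times between multiples of \<open>t0\<close>; the
    remainder \<open>r\<close> with row sums \<open>1 - \<delta>\<close> gives the
    contraction.\<close>
  have bound: "(\<Sum>l\<in>S. \<bar>\<Sum>k\<in>S. d t k * a k l\<bar>) \<le> b * D t"
    if a: "\<And>k l. k \<in> S \<Longrightarrow> l \<in> S \<Longrightarrow> 0 \<le> a k l" "\<And>k. k \<in> S \<Longrightarrow> (\<Sum>l\<in>S. a k l) = b" for a b t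
  proof -
    have "(\<Sum>l\<in>S. \<bar>\<Sum>k\<in>S. d t k * a k l\<bar>) \<le> (\<Sum>l\<in>S. \<Sum>k\<in>S. \<bar>d t k * a k l\<bar>)"
      by (intro sum_mono sum_abs)
    also have "\<dots> = (\<Sum>l\<in>S. \<Sum>k\<in>S. \<bar>d t k\<bar> * a k l)"
      using a(1) by (intro sum.cong) (auto simp: abs_mult)
    also have "\<dots> = (\<Sum>k\<in>S. \<bar>d t k\<bar> * (\<Sum>l\<in>S. a k l))"
      by (subst sum.swap) (simp add: sum_distrib_left)
    also have "\<dots> = b * D t"
      using a(2) by (simp add: D_def sum_distrib_left mult.commute)
    finally show ?thesis .
  qed
  have mono: "D (t + s) \<le> D t" if "t \<ge> 0" "s \<ge> 0" for t s
    using bound[of "p s" 1 t] that d_step[OF that] transition_nonneg transition_row_sum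
    by (simp add: D_def)
  \<comment> \<open>Since \<open>d\<close> has total mass zero, the common mass \<open>\<delta>\<close> that all rows put on \<open>c\<close> cancels.\<close>
  have contr: "D (t + t0) \<le> (1 - \<delta>) * D t" if "t \<ge> 0" for t
  proof -
    have "d (t + t0) l = (\<Sum>k\<in>S. d t k * r k l)" if l: "l \<in> S" for l
    proof -
      have "(\<Sum>k\<in>S. d t k * r k l) = (\<Sum>k\<in>S. d t k * p t0 k l) - (\<Sum>k\<in>S. d t k) * (if l = c then \<delta> else 0)"
        unfolding r_def right_diff_distrib sum_subtractf sum_distrib_right ..
      then show ?thesis using d_sum d_step \<open>t \<ge> 0\<close> t0 l by simp
    qed
    then show ?thesis using bound[of r "1 - \<delta>" t] r_nonneg r_sum by (simp add: D_def)
  qed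
  have geo: "D (real n * t0) \<le> (1 - \<delta>) ^ n * D 0" for n
  proof (induction n)
    case (Suc n)
    have "D (real n * t0 + t0) \<le> (1 - \<delta>) * D (real n * t0)"
      using t0 by (intro contr) auto
    also have "\<dots> \<le> (1 - \<delta>) * ((1 - \<delta>) ^ n * D 0)"
      using Suc \<delta>1 by (intro mult_left_mono) auto
    finally show ?case by (simp add: algebra_simps)
  qed simp
  have D_nonneg: "0 \<le> D t" for t by (simp add: D_def sum_nonneg)
  have "(\<lambda>n. (1 - \<delta>) ^ n * D 0) \<longlonglongrightarrow> 0 * D 0"
    using \<delta> \<delta>1 by (intro tendsto_intros LIMSEQ_realpow_zero) auto
  then have lim: "(\<lambda>n. (1 - \<delta>) ^ n * D 0) \<longlonglongrightarrow> 0" by simp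
  have D_lim: "(D \<longlongrightarrow> 0) at_top"
  proof (rule tendstoI)
    fix \<epsilon> :: real assume "\<epsilon> > 0"
    then obtain n where n: "(1 - \<delta>) ^ n * D 0 < \<epsilon>"
      using order_tendstoD(2)[OF lim] eventually_happens by fastforce
    show "\<forall>\<^sub>F t in at_top. dist (D t) 0 < \<epsilon>"
      using eventually_ge_at_top[of "real n * t0"]
    proof eventually_elim
      case (elim t)
      have "D t \<le> D (real n * t0)"
        using mono[of "real n * t0" "t - real n * t0"] elim t0 by simp
      then show ?case using geo[of n] n D_nonneg[of t] by simp
    qed
  qed
  have "((\<lambda>t. p t i j - \<pi> j) \<longlongrightarrow> 0) at_top"
  proof (rule Lim_null_comparison[OF _ D_lim])
    have "norm (p t i j - \<pi> j) \<le> D t" for t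
      using member_le_sum[of j S "\<lambda>k. \<bar>d t k\<bar>"] finite_states j by (simp add: D_def d_def)
    then show "\<forall>\<^sub>F t in at_top. norm (p t i j - \<pi> j) \<le> D t" by simp
  qed
  then show ?thesis by (simp add: LIM_zero_iff)
qed

end

section \<open>From the semigroup to the laws of a process with arbitrary initial law\<close>

lemma ctmc_expectation_tendsto:
  fixes \<Omega> :: "'w measure" and X :: "real \<Rightarrow> 'w \<Rightarrow> 's" and \<pi> h :: "'s \<Rightarrow> real"
  assumes X: "ctmc \<Omega> S q X"
    and db: "\<And>i j. i \<in> S \<Longrightarrow> j \<in> S \<Longrightarrow> i \<noteq> j \<Longrightarrow> \<pi> i * q i j = \<pi> j * q j i"
    and sum1: "(\<Sum>i\<in>S. \<pi> i) = 1"
    and c: "c \<in> S"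
    and reach: "\<And>i. i \<in> S \<Longrightarrow> (i, c) \<in> {(a, b). a \<in> S \<and> b \<in> S \<and> a \<noteq> b \<and> q a b > 0}\<^sup>*"
  shows "((\<lambda>t. \<integral>\<omega>. h (X t \<omega>) \<partial>\<Omega>) \<longlongrightarrow> (\<Sum>s\<in>S. h s * \<pi> s)) at_top"
proof -
  interpret prob_space \<Omega> using X by (simp add: ctmc_def)
  obtain p where tf: "transition_function S q p"
    and markov: "\<And>(n::nat) \<tau> s. 0 \<le> \<tau> 0 \<Longrightarrow> (\<forall>i\<le>n. \<tau> i < \<tau> (Suc i)) \<Longrightarrow> (\<forall>i\<le>Suc n. s i \<in> S) \<Longrightarrow>
           \<P>(\<omega> in \<Omega>. \<forall>i\<le>n. X (\<tau> i) \<omega> = s i) > 0 \<Longrightarrow>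
           \<P>(\<omega> in \<Omega>. X (\<tau> (Suc n)) \<omega> = s (Suc n) \<bar> \<forall>i\<le>n. X (\<tau> i) \<omega> = s i)
             = p (\<tau> (Suc n) - \<tau> n) (s n) (s (Suc n))"
    using X unfolding ctmc_def by blast
  have fin: "finite S" using tf by (rule finite_states)
  define ev where "ev t i = {\<omega> \<in> space \<Omega>. X t \<omega> = i}" for t i
  have ev_sets: "ev t i \<in> sets \<Omega>" if "0 \<le> t" "i \<in> S" for t i
  proof -
    have "X t -` {i} \<inter> space \<Omega> \<in> sets \<Omega>"
      using X that by (intro measurable_sets[of _ _ "count_space S"]) (auto simp: ctmc_def)
    moreover have "X t -` {i} \<inter> space \<Omega> = ev t i" by (auto simp: ev_def)
    ultimately show ?thesis by simp
  qed
  have X_mem: "X t \<omega> \<in> S" if "0 \<le> t" "\<omega> \<in> space \<Omega>" for t \<omega>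
  proof -
    have "X t \<in> measurable \<Omega> (count_space S)" using X that by (simp add: ctmc_def)
    from measurable_space[OF this that(2)] show ?thesis by simp
  qed
  have partition: "prob A = (\<Sum>i\<in>S. prob (ev 0 i \<inter> A))" if "A \<in> sets \<Omega>" for A
  proof -
    have "A = (\<Union>i\<in>S. ev 0 i \<inter> A)"
      using sets.sets_into_space[OF that] X_mem[of 0] by (auto simp: ev_def)
    then have "prob A = prob (\<Union>i\<in>S. ev 0 i \<inter> A)" by simp
    also have "\<dots> = (\<Sum>i\<in>S. prob (ev 0 i \<inter> A))"
      using ev_sets that fin
      by (intro finite_measure_finite_Union) (auto simp: disjoint_family_on_def ev_def)
    finally show ?thesis .
  qed
  \<comment> \<open>The Markov property is used for the two times 0 and \<open>t\<close> only. It
    asks for strictly increasing times and a conditioning event of positive probability, hence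
    \<open>0 < t\<close> and the separate null case.\<close>
  have joint: "prob (ev 0 i \<inter> ev t j) = prob (ev 0 i) * p t i j"
    if t: "0 < t" and i: "i \<in> S" and j: "j \<in> S" for t i j
  proof (cases "prob (ev 0 i) = 0")
    case True
    moreover have "prob (ev 0 i \<inter> ev t j) \<le> prob (ev 0 i)"
      using ev_sets t i j by (intro finite_measure_mono) auto
    ultimately show ?thesis using measure_nonneg[of \<Omega> "ev 0 i \<inter> ev t j"] by simp
  next
    case False
    have ev_eq: "{\<omega> \<in> space \<Omega>. X 0 \<omega> = i} = ev 0 i"
      "{\<omega> \<in> space \<Omega>. X t \<omega> = j \<and> X 0 \<omega> = i} = ev 0 i \<inter> ev t j"
      by (auto simp: ev_def)
    have "prob (ev 0 i) > 0" using False measure_nonneg[of \<Omega> "ev 0 i"] by linarith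
    then have "\<P>(\<omega> in \<Omega>. X t \<omega> = j \<bar> X 0 \<omega> = i) = p t i j"
      using markov[of "\<lambda>n. if n = 0 then 0 else t" 0 "\<lambda>n. if n = 0 then i else j"] t i j
      by (simp add: ev_eq)
    then have "prob (ev 0 i \<inter> ev t j) / prob (ev 0 i) = p t i j"
      by (simp add: cond_prob_def ev_eq)
    then show ?thesis using False by (simp add: field_simps)
  qed
  have init: "(\<Sum>i\<in>S. prob (ev 0 i)) = 1"
  proof -
    have "ev 0 i \<inter> space \<Omega> = ev 0 i" for i by (auto simp: ev_def)
    then show ?thesis using partition[of "space \<Omega>"] prob_space by simp
  qed
  have law: "((\<lambda>t. prob (ev t j)) \<longlongrightarrow> \<pi> j) at_top" if j: "j \<in> S" for j
  proof (rule Lim_transform_eventually)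
    \<comment> \<open>The limit of \<open>p t i j\<close> does not depend on \<open>i\<close>, so
      the initial law averages out.\<close>
    have "((\<lambda>t. \<Sum>i\<in>S. prob (ev 0 i) * p t i j) \<longlongrightarrow> (\<Sum>i\<in>S. prob (ev 0 i) * \<pi> j)) at_top"
      using transition_function_converges[OF tf db sum1 c reach _ j]
      by (intro tendsto_sum tendsto_mult tendsto_const) auto
    then show "((\<lambda>t. \<Sum>i\<in>S. prob (ev 0 i) * p t i j) \<longlongrightarrow> \<pi> j) at_top"
      by (simp add: sum_distrib_right[symmetric] init)
    show "\<forall>\<^sub>F t in at_top. (\<Sum>i\<in>S. prob (ev 0 i) * p t i j) = prob (ev t j)"
      using eventually_gt_at_top[of 0]
    proof eventually_elim
      case (elim t)
      then show ?case using partition[OF ev_sets[of t j]] joint[of t _ j] j by simp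
    qed
  qed
  show ?thesis
  proof (rule Lim_transform_eventually)
    show "((\<lambda>t. \<Sum>s\<in>S. h s * prob (ev t s)) \<longlongrightarrow> (\<Sum>s\<in>S. h s * \<pi> s)) at_top"
      by (intro tendsto_sum tendsto_mult tendsto_const law)
    show "\<forall>\<^sub>F t in at_top. (\<Sum>s\<in>S. h s * prob (ev t s)) = (\<integral>\<omega>. h (X t \<omega>) \<partial>\<Omega>)"
      using eventually_ge_at_top[of 0]
    proof eventually_elim
      case (elim t)
      have "(\<integral>\<omega>. h (X t \<omega>) \<partial>\<Omega>) = (\<integral>\<omega>. (\<Sum>s\<in>S. h s * indicator (ev t s) \<omega>) \<partial>\<Omega>)"
      proof (rule Bochner_Integration.integral_cong)
        fix \<omega> assume \<omega>: "\<omega> \<in> space \<Omega>"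
        have "(\<Sum>s\<in>S. h s * indicator (ev t s) \<omega>) = (\<Sum>s\<in>S. if s = X t \<omega> then h s else 0)"
          using \<omega> by (intro sum.cong) (auto simp: ev_def indicator_def)
        then show "h (X t \<omega>) = (\<Sum>s\<in>S. h s * indicator (ev t s) \<omega>)"
          using X_mem[OF elim \<omega>] fin by simp
      qed simp
      also have "\<dots> = (\<Sum>s\<in>S. \<integral>\<omega>. h s * indicator (ev t s) \<omega> \<partial>\<Omega>)"
        using ev_sets[OF elim] by (intro Bochner_Integration.integral_sum) (auto simp: less_top[symmetric])
      also have "\<dots> = (\<Sum>s\<in>S. h s * prob (ev t s))"
        by (intro sum.cong) (auto simp: ev_def Int_def conj_commute)
      finally show ?case ..
    qed
  qed
qed

section \<open>Gibbs measures\<close>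

lemma sum_exp_pos: "finite A \<Longrightarrow> A \<noteq> {} \<Longrightarrow> 0 < (\<Sum>b\<in>A. exp (\<gamma> * \<Psi> b :: real))"
  by (intro sum_pos) auto

lemma prob_space_gibbs:
  assumes "finite A" "A \<noteq> {}"
  shows "prob_space (gibbs A \<Psi> \<gamma>)"
proof
  let ?w = "\<lambda>a. if a \<in> A then exp (\<gamma> * \<Psi> a) / (\<Sum>b\<in>A. exp (\<gamma> * \<Psi> b)) else 0"
  have "emeasure (gibbs A \<Psi> \<gamma>) (space (gibbs A \<Psi> \<gamma>)) = (\<integral>\<^sup>+a. ennreal (?w a) \<partial>count_space UNIV)"
    by (simp add: gibbs_def emeasure_density)
  also have "\<dots> = (\<Sum>a\<in>A. ennreal (?w a))"
    using assms by (intro nn_integral_count_space') auto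
  also have "\<dots> = ennreal (\<Sum>a\<in>A. ?w a)"
    by (intro sum_ennreal) (auto intro!: divide_nonneg_nonneg sum_nonneg)
  also have "(\<Sum>a\<in>A. ?w a) = 1"
    using sum_exp_pos[OF assms, of \<gamma> \<Psi>] by (simp add: sum_divide_distrib[symmetric])
  finally show "emeasure (gibbs A \<Psi> \<gamma>) (space (gibbs A \<Psi> \<gamma>)) = 1" by simp
qed

lemma integral_gibbs:
  fixes f :: "'a \<Rightarrow> real"
  assumes "finite A"
  shows "(\<integral>a. f a \<partial>gibbs A \<Psi> \<gamma>) = (\<Sum>a\<in>A. exp (\<gamma> * \<Psi> a) * f a) / (\<Sum>b\<in>A. exp (\<gamma> * \<Psi> b))"
proof -
  let ?w = "\<lambda>a. if a \<in> A then exp (\<gamma> * \<Psi> a) / (\<Sum>b\<in>A. exp (\<gamma> * \<Psi> b)) else 0"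
  have "(\<integral>a. f a \<partial>gibbs A \<Psi> \<gamma>) = (\<integral>a. ?w a *\<^sub>R f a \<partial>count_space UNIV)"
    unfolding gibbs_def by (intro integral_density) (auto intro!: divide_nonneg_nonneg sum_nonneg)
  also have "\<dots> = (\<Sum>a\<in>A. ?w a *\<^sub>R f a)"
  proof -
    have "finite {a \<in> UNIV. ?w a *\<^sub>R f a \<noteq> 0}"
      by (rule finite_subset[OF _ assms]) (auto split: if_splits)
    then show ?thesis
      using assms by (subst lebesgue_integral_count_space_finite_support)
        (auto intro!: sum.mono_neutral_left split: if_splits)
  qed
  also have "\<dots> = (\<Sum>a\<in>A. exp (\<gamma> * \<Psi> a) * f a) / (\<Sum>b\<in>A. exp (\<gamma> * \<Psi> b))"
    by (simp add: sum_divide_distrib)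
  finally show ?thesis .
qed

lemma AE_gibbs: "AE a in gibbs A \<Psi> \<gamma>. a \<in> A"
  unfolding gibbs_def by (subst AE_density) (auto simp: AE_count_space)

text \<open>After division of numerator and denominator by \<open>exp (\<gamma> * m)\<close>, with
  \<open>m\<close> the maximum, the weights tend to 1 on maximizers and to 0 elsewhere.
  \<open>gibbs B \<Psi> 0\<close> is the uniform distribution on the maximizers, all weights being
  \<open>exp 0\<close>.\<close>

lemma gibbs_tendsto_argmax:
  fixes \<Psi> :: "'a \<Rightarrow> real"
  assumes A: "finite A" "A \<noteq> {}"
  defines "B \<equiv> {a. is_arg_max \<Psi> (\<lambda>a. a \<in> A) a}"
  shows "finite B" "B \<noteq> {}" "weak_conv_discrete (gibbs A \<Psi>) (gibbs B \<Psi> 0) at_top"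
proof -
  define m where "m = Max (\<Psi> ` A)"
  have B: "B = {a \<in> A. \<Psi> a = m}"
    using A by (auto simp: B_def is_arg_max_linorder m_def intro: Max_eqI[symmetric])
  then show "finite B" using A by simp
  have "m \<in> \<Psi> ` A" using A by (simp add: m_def)
  then show "B \<noteq> {}" using B by auto
  have weight: "((\<lambda>\<gamma>. exp (\<gamma> * (\<Psi> a - m))) \<longlongrightarrow> (if a \<in> B then 1 else 0)) at_top" if a: "a \<in> A" for a
  proof (cases "\<Psi> a = m")
    case True
    then show ?thesis using a B by simp
  next
    case False
    moreover have "\<Psi> a \<le> m" using A a by (simp add: m_def)
    ultimately have "\<Psi> a - m < 0" by simp
    then have "((\<lambda>\<gamma>. exp (\<gamma> * (\<Psi> a - m))) \<longlongrightarrow> 0) at_top" by real_asymp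
    then show ?thesis using False B by simp
  qed
  show "weak_conv_discrete (gibbs A \<Psi>) (gibbs B \<Psi> 0) at_top"
    unfolding weak_conv_discrete_def
  proof (intro allI impI)
    fix f :: "'a \<Rightarrow> real"
    have "((\<lambda>\<gamma>. (\<Sum>a\<in>A. exp (\<gamma> * (\<Psi> a - m)) * f a) / (\<Sum>a\<in>A. exp (\<gamma> * (\<Psi> a - m)))) \<longlongrightarrow>
        (\<Sum>a\<in>A. (if a \<in> B then 1 else 0) * f a) / (\<Sum>a\<in>A. if a \<in> B then 1 else 0)) at_top"
      using \<open>finite B\<close> \<open>B \<noteq> {}\<close> A B
      by (intro tendsto_divide tendsto_sum tendsto_mult tendsto_const weight)
        (auto simp: sum.If_cases Int_def)
    moreover have "(\<Sum>a\<in>A. (if a \<in> B then 1 else 0) * f a) = (\<Sum>a\<in>B. f a)"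
      using A B by (intro sum.mono_neutral_cong_right) auto
    moreover have "(\<Sum>a\<in>A. if a \<in> B then 1 else 0) = real (card B)"
    proof -
      have "(\<Sum>a\<in>A. if a \<in> B then 1 else 0) = (\<Sum>a\<in>B. 1 :: real)"
        using A B by (intro sum.mono_neutral_cong_right) auto
      then show ?thesis by simp
    qed
    moreover have "(\<Sum>a\<in>A. exp (\<gamma> * (\<Psi> a - m)) * f a) / (\<Sum>a\<in>A. exp (\<gamma> * (\<Psi> a - m))) =
        (\<integral>a. f a \<partial>gibbs A \<Psi> \<gamma>)" for \<gamma>
    proof -
      have "exp (\<gamma> * (\<Psi> a - m)) = exp (\<gamma> * \<Psi> a) * exp (- \<gamma> * m)" for a
        by (simp add: exp_add[symmetric] algebra_simps)
      then have "(\<Sum>a\<in>A. exp (\<gamma> * (\<Psi> a - m)) * f a) = (\<Sum>a\<in>A. exp (\<gamma> * \<Psi> a) * f a) * exp (- \<gamma> * m)"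
        "(\<Sum>a\<in>A. exp (\<gamma> * (\<Psi> a - m))) = (\<Sum>a\<in>A. exp (\<gamma> * \<Psi> a)) * exp (- \<gamma> * m)"
        by (simp_all add: sum_distrib_left sum_distrib_right mult_ac)
      then show ?thesis by (simp add: integral_gibbs[OF A(1)])
    qed
    moreover have "(\<integral>a. f a \<partial>gibbs B \<Psi> 0) = (\<Sum>a\<in>B. f a) / real (card B)"
      by (simp add: integral_gibbs[OF \<open>finite B\<close>])
    ultimately show "((\<lambda>\<gamma>. \<integral>a. f a \<partial>gibbs A \<Psi> \<gamma>) \<longlongrightarrow> (\<integral>a. f a \<partial>gibbs B \<Psi> 0)) at_top"
      by simp
  qed
qed

section \<open>Shifting units along edges\<close>

lemma total_eq_sum_row_sum: "total W = (\<Sum>x\<in>UNIV. row_sum W x)"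
  by (simp add: total_def row_sum_def)

lemma row_sum_unit_mat [simp]:
  "row_sum (unit_mat x y) a = (if a = x then 1 else 0)" for x :: "'x::finite"
  by (simp add: row_sum_def unit_mat_def)

lemma col_sum_unit_mat [simp]:
  "col_sum (unit_mat x y) b = (if b = y then 1 else 0)" for x :: "'x::finite"
  by (simp add: col_sum_def unit_mat_def)

lemma total_unit_mat [simp]: "total (unit_mat x y) = 1" for x :: "'x::finite"
  by (simp add: total_eq_sum_row_sum)

lemma total_mono: "(\<And>x y. W x y \<le> W' x y) \<Longrightarrow> total W \<le> total W'" for W :: "('x::finite) alloc"
  unfolding total_def by (intro sum_mono)

lemma total_add: "total (\<lambda>x y. W x y + W' x y) = total W + total W'" for W :: "('x::finite) alloc"
  by (simp add: total_def sum.distrib)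

text \<open>Pairs a deficit with a surplus. The inequality of sums suffices; rows of full
  allocations have equal sums, while for columns only saturation of one of the two is known.\<close>

lemma exists_less_of_sum_eq:
  fixes u v :: "'a::finite \<Rightarrow> nat"
  assumes "sum u UNIV \<le> sum v UNIV" "v x < u x"
  shows "\<exists>y. u y < v y"
proof (rule ccontr)
  assume "\<not> ?thesis"
  then have "sum v UNIV < sum u UNIV"
    using assms(2) by (intro sum_strict_mono_ex1) (auto simp: not_less)
  then show False using assms(1) by simp
qed

text \<open>The move of the second admissibility clause, with the source column before the target.
  The truncated subtraction is exact when \<open>0 < W x y'\<close>; the lemmas on sums are
  therefore stated additively.\<close>

definition shift :: "'x \<Rightarrow> 'x \<Rightarrow> 'x \<Rightarrow> 'x alloc \<Rightarrow> 'x alloc" where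
  "shift x y' y W = (\<lambda>a b. W a b + unit_mat x y a b - unit_mat x y' a b)"

lemma shift_add:
  assumes "0 < W x y'"
  shows "shift x y' y W a b + unit_mat x y' a b = W a b + unit_mat x y a b"
  using assms by (auto simp: shift_def unit_mat_def)

lemma row_sum_shift:
  fixes W :: "('x::finite) alloc"
  assumes "0 < W x y'"
  shows "row_sum (shift x y' y W) a = row_sum W a"
proof -
  have "row_sum (shift x y' y W) a + row_sum (unit_mat x y') a = row_sum W a + row_sum (unit_mat x y) a"
    unfolding row_sum_def sum.distrib[symmetric] by (simp add: shift_add[of W x y', OF assms])
  then show ?thesis by (simp split: if_splits)
qed

lemma col_sum_shift:
  fixes W :: "('x::finite) alloc"
  assumes "0 < W x y'"
  shows "col_sum (shift x y' y W) b + (if b = y' then 1 else 0) = col_sum W b + (if b = y then 1 else 0)"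
proof -
  have "col_sum (shift x y' y W) b + col_sum (unit_mat x y') b = col_sum W b + col_sum (unit_mat x y) b"
    unfolding col_sum_def sum.distrib[symmetric] by (simp add: shift_add[of W x y', OF assms])
  then show ?thesis by simp
qed

lemma shift_mem_partial_allocs:
  fixes W :: "('x::finite) alloc"
  assumes W: "W \<in> partial_allocs E \<alpha> \<beta>" and pos: "0 < W x y'" and e: "(x, y) \<in> E"
    and y: "col_sum W y < \<beta> y"
  shows "shift x y' y W \<in> partial_allocs E \<alpha> \<beta>"
  unfolding partial_allocs_def mem_Collect_eq
proof (intro conjI allI impI)
  fix a b assume "(a, b) \<notin> E"
  then show "shift x y' y W a b = 0"
    using W e by (auto simp: partial_allocs_def shift_def unit_mat_def)
next
  fix a show "row_sum (shift x y' y W) a \<le> \<alpha> a"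
    using W by (simp add: row_sum_shift[of W x y', OF pos] partial_allocs_def)
next
  fix b
  have "col_sum W b \<le> \<beta> b" using W by (simp add: partial_allocs_def)
  then show "col_sum (shift x y' y W) b \<le> \<beta> b"
    using col_sum_shift[of W x y', OF pos, of y b] y by (auto split: if_splits)
qed

lemma shift_mem_allocs:
  fixes W :: "('x::finite) alloc"
  assumes "W \<in> allocs E \<alpha> \<beta>" "0 < W x y'" "(x, y) \<in> E" "col_sum W y < \<beta> y"
  shows "shift x y' y W \<in> allocs E \<alpha> \<beta>"
  using assms shift_mem_partial_allocs[of W] by (simp add: allocs_def row_sum_shift)

lemma finite_partial_allocs:
  fixes E :: "('x::finite \<times> 'x) set"
  shows "finite (partial_allocs E \<alpha> \<beta>)"
proof (rule finite_subset)
  define B where "B = PiE (UNIV :: 'x set) (\<lambda>x. PiE (UNIV :: 'x set) (\<lambda>y. {..\<alpha> x}))"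
  show "finite B" unfolding B_def by (intro finite_PiE) auto
  have "W x y \<le> \<alpha> x" if "W \<in> partial_allocs E \<alpha> \<beta>" for W x y
  proof -
    have "W x y \<le> row_sum W x" unfolding row_sum_def by (rule member_le_sum) auto
    also have "\<dots> \<le> \<alpha> x" using that by (simp add: partial_allocs_def)
    finally show ?thesis .
  qed
  then show "partial_allocs E \<alpha> \<beta> \<subseteq> B" by (auto simp: B_def PiE_def)
qed

lemma allocs_partial: "allocs E \<alpha> \<beta> \<subseteq> partial_allocs E \<alpha> \<beta>"
  by (auto simp: allocs_def)

lemma finite_allocs: "finite (allocs E \<alpha> \<beta>)" for E :: "('x::finite \<times> 'x) set"
  by (rule finite_subset[OF allocs_partial finite_partial_allocs])

lemma move_row_moves:
  assumes "admissible E \<alpha> \<beta> \<M>" "W \<in> partial_allocs E \<alpha> \<beta>" "\<xi> z" "W' \<in> \<M> z W \<xi>"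
  shows "W' \<in> row_moves E \<alpha> \<beta> z W \<xi>"
  using assms(1)[unfolded admissible_def, THEN conjunct1] assms(2-) by blast

lemma move_sym:
  assumes "admissible E \<alpha> \<beta> \<M>" "W \<in> allocs E \<alpha> \<beta>" "W' \<in> allocs E \<alpha> \<beta>" "\<xi> z"
  shows "W' \<in> \<M> z W \<xi> \<longleftrightarrow> W \<in> \<M> z W' \<xi>"
  using assms(1)[unfolded admissible_def, THEN conjunct2, THEN conjunct2, THEN conjunct2] assms(2-)
  by simp

section \<open>Alternating paths\<close>

text \<open>Columns reachable from \<open>D\<close> by alternating paths of length at most \<open>n\<close>: leave a column through a
  row that uses it, and enter any neighbour of that row.\<close>

primrec reach_cols :: "('x \<times> 'x) set \<Rightarrow> 'x set \<Rightarrow> 'x alloc \<Rightarrow> nat \<Rightarrow> 'x set" where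
  "reach_cols E D W 0 = D"
| "reach_cols E D W (Suc n) = reach_cols E D W n \<union>
     {y. \<exists>x y'. y' \<in> reach_cols E D W n \<and> 0 < W x y' \<and> (x, y) \<in> E}"

lemma reach_cols_subset: "D \<subseteq> reach_cols E D W n"
  by (induction n) auto

text \<open>Only column \<open>y'\<close> may have lost units, so an alternating path can break only
  where it leaves \<open>y'\<close>, and then \<open>y'\<close> has already been reached. For
  \<open>z = y'\<close> the alternatives coincide: \<open>y'\<close> stays reachable after a unit is
  shifted out of it.\<close>

lemma reach_cols_mono_off_column:
  assumes "\<And>a b. b \<noteq> y' \<Longrightarrow> W a b \<le> W' a b"
    and "z \<in> reach_cols E D W n"
  shows "z \<in> reach_cols E D W' n \<or> y' \<in> reach_cols E D W' n"
  using assms(2)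
proof (induction n arbitrary: z)
  case (Suc n)
  show ?case
  proof (cases "z \<in> reach_cols E D W n \<or> y' \<in> reach_cols E D W' n")
    case False
    then obtain x w where xw: "w \<in> reach_cols E D W n" "0 < W x w" "(x, z) \<in> E"
      using Suc.prems by auto
    then have "w \<in> reach_cols E D W' n" "w \<noteq> y'" using Suc.IH False by blast+
    moreover from this have "0 < W' x w" using assms(1)[of w x] xw by simp
    ultimately show ?thesis using xw by auto
  qed (use Suc.IH in auto)
qed simp

text \<open>If a free column were reachable, shifting a unit into it would free the previous column of
  the path; repeating this brings the free column back to \<open>D\<close>.\<close>

lemma reach_cols_saturated:
  fixes W :: "('x::finite) alloc"
  assumes bound: "\<And>V y. Q V \<Longrightarrow> col_sum V y \<le> \<beta> y"
    and D: "\<And>V y. Q V \<Longrightarrow> y \<in> D \<Longrightarrow> \<not> col_sum V y < \<beta> y"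
    and shift: "\<And>V x y y'. Q V \<Longrightarrow> 0 < V x y' \<Longrightarrow> y' \<notin> D \<Longrightarrow> y' \<noteq> y \<Longrightarrow> (x, y) \<in> E \<Longrightarrow>
        col_sum V y < \<beta> y \<Longrightarrow> Q (shift x y' y V)"
    and exits: "\<And>V x y y'. Q V \<Longrightarrow> 0 < V x y' \<Longrightarrow> y' \<in> D \<Longrightarrow> y \<notin> D \<Longrightarrow> (x, y) \<in> E \<Longrightarrow>
        \<not> col_sum V y < \<beta> y"
    and "Q W" "y \<in> reach_cols E D W n"
  shows "\<not> col_sum W y < \<beta> y"
  using assms(5-6)
proof (induction n arbitrary: W y)
  case 0
  then show ?case using D by simp
next
  case (Suc n)
  show ?case
  proof (cases "y \<in> reach_cols E D W n")
    case True
    then show ?thesis using Suc by blast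
  next
    case False
    then obtain x y' where y': "y' \<in> reach_cols E D W n" "0 < W x y'" "(x, y) \<in> E"
      using Suc.prems by auto
    have "y \<notin> D" using False reach_cols_subset by fast
    show ?thesis
    proof
      assume free: "col_sum W y < \<beta> y"
      have "y' \<noteq> y" using False y' by auto
      \<comment> \<open>A shift out of a column of \<open>D\<close> need not preserve
        \<open>Q\<close>, so the first edge of the path is left to \<open>exits\<close>.\<close>
      have "y' \<notin> D" using exits Suc.prems(1) y' \<open>y \<notin> D\<close> free by blast
      then have Q: "Q (shift x y' y W)" using shift Suc.prems(1) y' \<open>y' \<noteq> y\<close> free by blast
      \<comment> \<open>The induction hypothesis is applied to the shifted allocation. It declares
        \<open>y'\<close> saturated, although \<open>y'\<close> has just lost a unit and held at
        most \<open>\<beta> y'\<close> before.\<close>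
      have "y' \<in> reach_cols E D (shift x y' y W) n"
        using reach_cols_mono_off_column[of y' W "shift x y' y W" y' E D n] y'(1)
        by (auto simp: shift_def unit_mat_def)
      with Q have "\<not> col_sum (shift x y' y W) y' < \<beta> y'" by (rule Suc.IH)
      then show False
        using col_sum_shift[of W x y', OF y'(2), of y y'] bound[OF Suc.prems(1), of y'] \<open>y' \<noteq> y\<close> by simp
    qed
  qed
qed

context
  fixes E :: "('x::finite \<times> 'x) set" and \<alpha> \<beta> :: "'x \<Rightarrow> nat"
  assumes hall: "\<forall>A :: 'x set. A \<noteq> {} \<longrightarrow> (\<Sum>x\<in>A. \<alpha> x) < (\<Sum>y\<in>(\<Union>x\<in>A. nbrs E x). \<beta> y)"
begin

text \<open>If all reachable columns \<open>R\<close> were saturated, any row using one of them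
  would have all its neighbours in \<open>R\<close>, so the rows \<open>A\<close> alone would fill
  \<open>R\<close>, against the strict Hall condition. The assumption \<open>start\<close> puts
  \<open>x\<close> into \<open>A\<close>, which is thus nonempty.\<close>

lemma exists_free_reach_cols:
  assumes W: "W \<in> partial_allocs E \<alpha> \<beta>"
    and start: "nbrs E x \<subseteq> D \<or> (\<exists>y\<in>D. 0 < W x y)"
  shows "\<exists>n. \<exists>y \<in> reach_cols E D W n. col_sum W y < \<beta> y"
proof (rule ccontr)
  define R where "R = (\<Union>n. reach_cols E D W n)"
  assume "\<not> ?thesis"
  then have sat: "\<beta> y \<le> col_sum W y" if "y \<in> R" for y
    using that by (auto simp: R_def not_less)
  have closed: "y \<in> R" if "y' \<in> R" "0 < W x y'" "(x, y) \<in> E" for x y y'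
  proof -
    obtain n where "y' \<in> reach_cols E D W n" using \<open>y' \<in> R\<close> unfolding R_def by blast
    then have "y \<in> reach_cols E D W (Suc n)" using that by auto
    then show ?thesis unfolding R_def by blast
  qed
  have DR: "D \<subseteq> R" using reach_cols_subset unfolding R_def by fast
  define A where "A = {x. nbrs E x \<subseteq> R}"
  have A: "x \<in> A" if "y \<in> R" "0 < W x y" for x y
    using closed that by (auto simp: A_def nbrs_def)
  have "x \<in> A" using start DR A by (auto simp: A_def)
  then have "(\<Sum>x\<in>A. \<alpha> x) < (\<Sum>y\<in>(\<Union>x\<in>A. nbrs E x). \<beta> y)" using hall by blast
  also have "\<dots> \<le> (\<Sum>y\<in>R. \<beta> y)" by (intro sum_mono2) (auto simp: A_def)
  also have "\<dots> \<le> (\<Sum>y\<in>R. \<Sum>x\<in>UNIV. W x y)"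
    using sat by (intro sum_mono) (simp add: col_sum_def)
  also have "\<dots> = (\<Sum>x\<in>UNIV. \<Sum>y\<in>R. W x y)" by (rule sum.swap)
  also have "\<dots> = (\<Sum>x\<in>A. \<Sum>y\<in>R. W x y)"
    using A by (intro sum.mono_neutral_right) auto
  also have "\<dots> \<le> (\<Sum>x\<in>A. row_sum W x)"
    unfolding row_sum_def by (intro sum_mono sum_mono2) auto
  also have "\<dots> \<le> (\<Sum>x\<in>A. \<alpha> x)"
    using W by (intro sum_mono) (simp add: partial_allocs_def)
  finally show False by simp
qed

section \<open>Irreducibility of the allocation dynamics\<close>

context
  fixes \<M> :: "'x \<Rightarrow> 'x alloc \<Rightarrow> ('x \<Rightarrow> bool) \<Rightarrow> 'x alloc set"
  assumes adm: "admissible E \<alpha> \<beta> \<M>"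
begin

text \<open>With all vertices on, a neighbouring column is available exactly when it is below
  capacity, and every row may move.\<close>

definition full_moves :: "('x alloc \<times> 'x alloc) set" where
  "full_moves = {(W, W'). W \<in> partial_allocs E \<alpha> \<beta> \<and> (\<exists>z. W' \<in> \<M> z W (\<lambda>_. True))}"

lemma full_moves_partial_allocs:
  "(W, W') \<in> full_moves\<^sup>* \<Longrightarrow> W \<in> partial_allocs E \<alpha> \<beta> \<Longrightarrow> W' \<in> partial_allocs E \<alpha> \<beta>"
proof (induction rule: rtrancl_induct)
  case (step V W)
  then obtain z where "W \<in> row_moves E \<alpha> \<beta> z V (\<lambda>_. True)"
    using move_row_moves[OF adm, of V "\<lambda>_. True"] by (auto simp: full_moves_def)
  then show ?case by (simp add: row_moves_def)
qed

lemma full_moves_shift: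
  assumes "W \<in> partial_allocs E \<alpha> \<beta>" "0 < W x y'" "y' \<noteq> y" "(x, y) \<in> E" "col_sum W y < \<beta> y"
  shows "(W, shift x y' y W) \<in> full_moves"
proof -
  have y: "y \<in> avail_nbrs E \<beta> x W (\<lambda>_. True)"
    using assms by (simp add: avail_nbrs_def nbrs_def)
  have "(\<lambda>a b. W a b + unit_mat x y a b - unit_mat x y' a b) \<in> \<M> x W (\<lambda>_. True)"
    using adm[unfolded admissible_def, THEN conjunct2, THEN conjunct2, THEN conjunct1]
      assms(1-3) y by (simp add: eq_commute)
  then show ?thesis using assms(1) by (auto simp: full_moves_def shift_def)
qed

lemma full_moves_add:
  assumes "W \<in> partial_allocs E \<alpha> \<beta>" "row_sum W z < \<alpha> z" "(z, y) \<in> E" "col_sum W y < \<beta> y"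
  shows "\<exists>W'. (W, W') \<in> full_moves \<and> total W < total W'"
proof -
  have y: "y \<in> avail_nbrs E \<beta> z W (\<lambda>_. True)"
    using assms by (simp add: avail_nbrs_def nbrs_def)
  have "\<exists>n\<ge>1. (\<lambda>a b. W a b + n * unit_mat z y a b) \<in> \<M> z W (\<lambda>_. True)"
    using adm[unfolded admissible_def, THEN conjunct2, THEN conjunct1] assms(1,2) y by simp
  then obtain n where n: "n \<ge> 1" "(\<lambda>a b. W a b + n * unit_mat z y a b) \<in> \<M> z W (\<lambda>_. True)"
    by blast
  have "total (\<lambda>a b. W a b + n * unit_mat z y a b) = total W + n * total (unit_mat z y)"
    by (simp add: total_def sum.distrib sum_distrib_left)
  then have "total W < total (\<lambda>a b. W a b + n * unit_mat z y a b)" using n by simp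
  then show ?thesis using n assms(1) unfolding full_moves_def by blast
qed

text \<open>A free neighbour of \<open>z\<close> could receive a unit at once. Otherwise slack is
  transported to a neighbour of \<open>z\<close> by shifts, which change no row sum and hence keep
  \<open>z\<close> deficient.\<close>

lemma full_moves_increase_total:
  assumes W: "W \<in> partial_allocs E \<alpha> \<beta>" and z: "row_sum W z < \<alpha> z"
  shows "\<exists>W'. (W, W') \<in> full_moves\<^sup>* \<and> total W < total W'"
proof (rule ccontr)
  assume no: "\<not> ?thesis"
  \<comment> \<open>\<open>Q\<close> collects the states reachable from \<open>W\<close> without
    gain; by assumption no gain is ever possible, so in each of them all neighbours of
    \<open>z\<close> are saturated.\<close>
  define Q where "Q V \<longleftrightarrow> V \<in> partial_allocs E \<alpha> \<beta> \<and> (W, V) \<in> full_moves\<^sup>* \<and>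
    row_sum V z < \<alpha> z \<and> total V = total W" for V
  have Q_nbr: "\<not> col_sum V y < \<beta> y" if V: "Q V" and y: "y \<in> nbrs E z" for V y
  proof
    assume "col_sum V y < \<beta> y"
    then obtain V' where "(V, V') \<in> full_moves" "total V < total V'"
      using full_moves_add[of V z y] V y by (auto simp: Q_def nbrs_def)
    then show False using V no by (auto simp: Q_def dest: rtrancl_into_rtrancl)
  qed
  have Q_shift: "Q (shift x y' y V)"
    if V: "Q V" and pos: "0 < V x y'" and y: "y' \<noteq> y" "(x, y) \<in> E" "col_sum V y < \<beta> y" for V x y y'
    using V y full_moves_shift[of V x y' y] shift_mem_partial_allocs[of V E \<alpha> \<beta> x y' y] pos
    by (auto simp: Q_def row_sum_shift[of V x y', OF pos] total_eq_sum_row_sum)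
  have Q_bound: "col_sum V y \<le> \<beta> y" if "Q V" for V y
    using that by (simp add: Q_def partial_allocs_def)
  have "Q W" using W z by (simp add: Q_def)
  then have "\<not> col_sum W y < \<beta> y" if "y \<in> reach_cols E (nbrs E z) W n" for y n
  proof (rule reach_cols_saturated[of Q \<beta> "nbrs E z" E W y n, rotated 4])
    show "y \<in> reach_cols E (nbrs E z) W n" by (rule that)
  next
    fix V x y y'
    assume V: "Q V" "0 < V x y'" "y' \<in> nbrs E z" "y \<notin> nbrs E z" "(x, y) \<in> E"
    show "\<not> col_sum V y < \<beta> y"
    proof
      assume "col_sum V y < \<beta> y"
      then have "\<not> col_sum (shift x y' y V) y' < \<beta> y'" using V by (intro Q_nbr Q_shift) auto
      then show False using col_sum_shift[of V x y', OF V(2), of y y'] Q_bound[OF V(1), of y'] V by (auto split: if_splits)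
    qed
  qed (fact Q_bound Q_nbr | rule Q_shift; assumption)+
  then show False using exists_free_reach_cols[OF W, of z "nbrs E z"] by blast
qed

lemma full_moves_reach_allocs:
  assumes "W \<in> partial_allocs E \<alpha> \<beta>"
  shows "\<exists>W'\<in>allocs E \<alpha> \<beta>. (W, W') \<in> full_moves\<^sup>*"
  using assms
proof (induction "(\<Sum>x\<in>UNIV. \<alpha> x) - total W" arbitrary: W rule: less_induct)
  case less
  show ?case
  proof (cases "W \<in> allocs E \<alpha> \<beta>")
    case False
    then obtain z where "row_sum W z \<noteq> \<alpha> z" using less.prems by (auto simp: allocs_def)
    moreover have "row_sum W z \<le> \<alpha> z" using less.prems by (simp add: partial_allocs_def)
    ultimately have "row_sum W z < \<alpha> z" by simp
    then obtain V where V: "(W, V) \<in> full_moves\<^sup>*" "total W < total V"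
      using full_moves_increase_total[OF less.prems] by blast
    then have V': "V \<in> partial_allocs E \<alpha> \<beta>" using full_moves_partial_allocs[OF _ less.prems] by blast
    then have "total V \<le> (\<Sum>x\<in>UNIV. \<alpha> x)"
      unfolding total_eq_sum_row_sum by (intro sum_mono) (simp add: partial_allocs_def)
    then have "(\<Sum>x\<in>UNIV. \<alpha> x) - total V < (\<Sum>x\<in>UNIV. \<alpha> x) - total W" using V(2) by linarith
    then obtain W' where "W' \<in> allocs E \<alpha> \<beta>" "(V, W') \<in> full_moves\<^sup>*"
      using less.hyps[OF _ V'] by blast
    then show ?thesis using V by (meson rtrancl_trans)
  qed auto
qed

text \<open>The moves themselves build a full allocation from the zero allocation, so no matching
  theorem has to be invoked.\<close>

lemma allocs_nonempty: "allocs E \<alpha> \<beta> \<noteq> {}"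
proof -
  have "(\<lambda>_ _. 0) \<in> partial_allocs E \<alpha> \<beta>"
    by (simp add: partial_allocs_def row_sum_def col_sum_def)
  then show ?thesis using full_moves_reach_allocs by blast
qed

section \<open>Connectivity of the full allocations\<close>

definition excess :: "'x alloc \<Rightarrow> 'x alloc \<Rightarrow> nat" where
  "excess W W' = total (\<lambda>x y. W x y - W' x y)"

text \<open>Each excess completes the other allocation to the entrywise maximum, and totals agree.
  So on full allocations \<open>excess\<close> is half the l1 distance.\<close>

lemma excess_commute:
  assumes "W \<in> allocs E \<alpha> \<beta>" "W' \<in> allocs E \<alpha> \<beta>"
  shows "excess W W' = excess W' W"
proof -
  have "excess W W' + total W' = total (\<lambda>x y. max (W x y) (W' x y))"
    unfolding excess_def total_def sum.distrib[symmetric]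
    by (intro sum.cong refl) (simp add: max_def)
  moreover have "excess W' W + total W = total (\<lambda>x y. max (W x y) (W' x y))"
    unfolding excess_def total_def sum.distrib[symmetric]
    by (intro sum.cong refl) (simp add: max_def)
  moreover have "total W = total W'"
    using assms by (simp add: total_eq_sum_row_sum allocs_def)
  ultimately show ?thesis by simp
qed

definition alloc_moves :: "('x alloc \<times> 'x alloc) set" where
  "alloc_moves = full_moves \<inter> allocs E \<alpha> \<beta> \<times> allocs E \<alpha> \<beta>"

lemma sym_alloc_moves: "sym alloc_moves"
proof (rule symI)
  fix V V' assume "(V, V') \<in> alloc_moves"
  then obtain z where VV': "V \<in> allocs E \<alpha> \<beta>" "V' \<in> allocs E \<alpha> \<beta>" "V' \<in> \<M> z V (\<lambda>_. True)"
    by (auto simp: alloc_moves_def full_moves_def)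
  then have "V \<in> \<M> z V' (\<lambda>_. True)" using move_sym[OF adm, of V V' "\<lambda>_. True" z] by simp
  then show "(V', V) \<in> alloc_moves"
    using VV' by (auto simp: alloc_moves_def full_moves_def allocs_def)
qed

text \<open>In an unconnected pair at minimal distance every column where the two differ is
  saturated in both, as otherwise a shift into it decreases the distance. An alternating path
  from such a column to a free column has its intermediate columns outside the difference, so its
  shifts apply to both allocations; the last one frees a column of the difference.\<close>

lemma alloc_moves_connected:
  assumes "W \<in> allocs E \<alpha> \<beta>" "W' \<in> allocs E \<alpha> \<beta>"
  shows "(W, W') \<in> alloc_moves\<^sup>*"
  using assms
proof (induction "excess W W'" arbitrary: W W' rule: less_induct)
  case less
  define n where "n = excess W W'"
  \<comment> \<open>\<open>G\<close> holds for unconnected pairs at distance at most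
    \<open>n\<close>; by the induction hypothesis the distance is then exactly \<open>n\<close>.
    Being stable under suitable shifts, it lets the pair move along a path.\<close>
  define G where "G V V' \<longleftrightarrow> V \<in> allocs E \<alpha> \<beta> \<and> V' \<in> allocs E \<alpha> \<beta> \<and> excess V V' \<le> n \<and>
    (V, V') \<notin> alloc_moves\<^sup>*" for V V'
  define Diff where "Diff V V' = {y. \<exists>x. V x y \<noteq> V' x y}" for V V' :: "'x alloc"
  have conn_sym: "(V, V') \<in> alloc_moves\<^sup>* \<longleftrightarrow> (V', V) \<in> alloc_moves\<^sup>*" for V V'
    using sym_alloc_moves by (meson sym_rtrancl symD)
  have G_sym: "G V' V" if "G V V'" for V V'
    using that conn_sym[of V V'] excess_commute[of V V'] by (simp add: G_def)
  have G_excess: "\<not> excess V V' < n" if "G V V'" for V V'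
    using that less.hyps[of V V'] by (auto simp: G_def n_def)
  have shift_conn: "(V, shift x y' y V) \<in> alloc_moves"
    if "V \<in> allocs E \<alpha> \<beta>" "0 < V x y'" "y' \<noteq> y" "(x, y) \<in> E" "col_sum V y < \<beta> y" for V x y y'
    using full_moves_shift[of V x y' y] shift_mem_allocs[of V E \<alpha> \<beta> x y' y] that
    by (simp add: alloc_moves_def allocs_def)
  have G_shift_left: "G (shift x y' y V) V'"
    if G: "G V V'" and pos: "0 < V x y'" and y: "y' \<noteq> y" "(x, y) \<in> E" "col_sum V y < \<beta> y"
      and ex: "excess (shift x y' y V) V' \<le> n" for V V' x y y'
  proof -
    have "(V, shift x y' y V) \<in> alloc_moves" using G pos y by (intro shift_conn) (auto simp: G_def)
    then show ?thesis
      using G ex shift_mem_allocs[of V E \<alpha> \<beta> x y' y] pos y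
      by (auto simp: G_def dest: converse_rtrancl_into_rtrancl)
  qed
  \<comment> \<open>Connecting the shifted pair would connect the original one, the shift of
    \<open>V'\<close> being undone by symmetry. Equal changes in both do not raise the
    distance.\<close>
  have G_shift_both: "G (shift x y' y V) (shift x y' y V')"
    if G: "G V V'" and pos: "0 < V x y'" "0 < V' x y'"
      and y: "y' \<noteq> y" "(x, y) \<in> E" "col_sum V y < \<beta> y" "col_sum V' y < \<beta> y" for V V' x y y'
  proof -
    have "(V, shift x y' y V) \<in> alloc_moves" "(V', shift x y' y V') \<in> alloc_moves"
      using G pos y by (auto simp: G_def intro!: shift_conn)
    moreover from this(2) have "(shift x y' y V', V') \<in> alloc_moves"
      using sym_alloc_moves by (meson symD)
    moreover have "excess (shift x y' y V) (shift x y' y V') \<le> excess V V'"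
      unfolding excess_def by (rule total_mono) (use pos in \<open>auto simp: shift_def unit_mat_def\<close>)
    ultimately show ?thesis
      using G shift_mem_allocs[of V E \<alpha> \<beta> x y' y] shift_mem_allocs[of V' E \<alpha> \<beta> x y' y] pos y
      by (auto simp: G_def dest: converse_rtrancl_into_rtrancl rtrancl_into_rtrancl)
  qed
  have less_saturated: "col_sum V y = \<beta> y"
    if G: "G V V'" and y: "V x y < V' x y" for V V' x y
  proof (rule ccontr)
    assume "col_sum V y \<noteq> \<beta> y"
    then have free: "col_sum V y < \<beta> y"
      using G by (simp add: G_def allocs_def partial_allocs_def order_less_le)
    have e: "(x, y) \<in> E"
      using G y by (auto simp: G_def allocs_def partial_allocs_def)
    have "row_sum V' x = row_sum V x" using G by (simp add: G_def allocs_def)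
    then obtain y' where y': "V' x y' < V x y'"
      using exists_less_of_sum_eq[of "V' x" "V x" y] y by (auto simp: row_sum_def)
    then have "y' \<noteq> y" "0 < V x y'" using y by auto
    \<comment> \<open>Row \<open>x\<close> has a surplus at \<open>y'\<close> and a deficit at
      \<open>y\<close>. The added unit stands for the surplus unit removed, which turns the strict
      decrease into a plain inequality of totals.\<close>
    have "total (\<lambda>a b. (shift x y' y V a b - V' a b) + unit_mat x y' a b) \<le> excess V V'"
      unfolding excess_def by (rule total_mono) (use y y' in \<open>auto simp: shift_def unit_mat_def\<close>)
    then have ex: "excess (shift x y' y V) V' < n"
      using G by (simp add: excess_def total_add G_def)
    then have "G (shift x y' y V) V'"
      using G \<open>0 < V x y'\<close> \<open>y' \<noteq> y\<close> e free by (intro G_shift_left) auto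
    then show False using G_excess ex by blast
  qed
  have diff_saturated:
    "col_sum V y = \<beta> y \<and> col_sum V' y = \<beta> y \<and> (\<exists>x. V x y < V' x y) \<and> (\<exists>x. V' x y < V x y)"
    if G: "G V V'" and y: "y \<in> Diff V V'" for V V' y
  proof -
    \<comment> \<open>Where \<open>V\<close> is smaller its column is saturated, so it cannot lie
      below \<open>V'\<close> throughout that column. Hence both strict inequalities occur, and
      saturation follows for both allocations.\<close>
    have *: "\<exists>x. V' x y < V x y" if G: "G V V'" and x: "V x y < V' x y" for V V' x
    proof -
      have "col_sum V' y \<le> col_sum V y"
        using less_saturated[OF that] G by (simp add: G_def allocs_def partial_allocs_def)
      then show ?thesis
        using exists_less_of_sum_eq[of "\<lambda>x. V' x y" "\<lambda>x. V x y" x] x by (auto simp: col_sum_def)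
    qed
    obtain x where "V x y < V' x y \<or> V' x y < V x y"
      using y by (auto simp: Diff_def neq_iff)
    then have ex: "\<exists>x. V x y < V' x y" "\<exists>x. V' x y < V x y"
      using *[OF G] *[OF G_sym[OF G]] by blast+
    then show ?thesis using less_saturated[OF G] less_saturated[OF G_sym[OF G]] by blast
  qed
  show ?case
  proof (rule ccontr)
    assume "(W, W') \<notin> alloc_moves\<^sup>*"
    then have G: "G W W'" using less.prems by (simp add: G_def n_def)
    define D where "D = Diff W W'"
    \<comment> \<open>The partner \<open>V'\<close> may change along the path, but the set of
      differing columns stays \<open>D\<close>.\<close>
    define Q where "Q V \<longleftrightarrow> (\<exists>V'. G V V' \<and> Diff V V' = D)" for V
    have "Q W" using G by (auto simp: Q_def D_def)
    then have sat: "\<not> col_sum W y < \<beta> y" if "y \<in> reach_cols E D W m" for y m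
    proof (rule reach_cols_saturated[of Q \<beta> D E W y m, rotated 4])
      show "y \<in> reach_cols E D W m" by (rule that)
      show "col_sum V y \<le> \<beta> y" if "Q V" for V y
        using that by (auto simp: Q_def G_def allocs_def partial_allocs_def)
      show "\<not> col_sum V y < \<beta> y" if "Q V" "y \<in> D" for V y
        using that diff_saturated by (fastforce simp: Q_def)
    next
      fix V x y y'
      assume V: "Q V" "0 < V x y'" "y' \<notin> D" "y' \<noteq> y" "(x, y) \<in> E" "col_sum V y < \<beta> y"
      then obtain V' where V': "G V V'" "Diff V V' = D" by (auto simp: Q_def)
      \<comment> \<open>A free column lies outside \<open>D\<close>. Both columns of the shift thus
        agree in \<open>V\<close> and \<open>V'\<close>, so the same shift is possible in the
        partner.\<close>
      have "y \<notin> D" using diff_saturated[OF V'(1), of y] V' V(6) by auto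
      then have agree: "V a y = V' a y" "V a y' = V' a y'" for a
        using V(3) V'(2) by (auto simp: Diff_def)
      have "G (shift x y' y V) (shift x y' y V')"
        using V V' agree by (intro G_shift_both) (auto simp: col_sum_def)
      moreover have "Diff (shift x y' y V) (shift x y' y V') = D"
      proof -
        have "shift x y' y V a b \<noteq> shift x y' y V' a b \<longleftrightarrow> V a b \<noteq> V' a b" for a b
          using agree[of a] by (auto simp: shift_def unit_mat_def)
        then show ?thesis using V'(2) by (simp add: Diff_def)
      qed
      ultimately show "Q (shift x y' y V)" by (auto simp: Q_def)
    next
      fix V x y y'
      assume V: "Q V" "0 < V x y'" "y' \<in> D" "y \<notin> D" "(x, y) \<in> E"
      then obtain V' where V': "G V V'" "Diff V V' = D" by (auto simp: Q_def)
      have agree: "V a y = V' a y" for a using V(4) V'(2) by (auto simp: Diff_def)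
      have "y' \<noteq> y" using V by auto
      obtain x2 where x2: "V x2 y' < V' x2 y'" and sat: "col_sum V y' = \<beta> y'"
        using diff_saturated[OF V'(1), of y'] V V' by auto
      show "\<not> col_sum V y < \<beta> y"
      proof
        assume free: "col_sum V y < \<beta> y"
        have "\<exists>V''. G (shift x y' y V) V'' \<and> y' \<in> Diff (shift x y' y V) V''"
        \<comment> \<open>If the partner has no unit at \<open>(x, y')\<close>, only
          \<open>V\<close> is shifted: the excess unit moves from \<open>y'\<close> to
          \<open>y\<close>, so the distance does not grow, and \<open>x2\<close> differs from
          \<open>x\<close>. Otherwise both are shifted. Either way \<open>y'\<close> still differs
          at \<open>x2\<close> and must be saturated, yet it lost a unit.\<close>
        proof (cases "V' x y' = 0")
          case True
          have "total (\<lambda>a b. (shift x y' y V a b - V' a b) + unit_mat x y' a b) \<le>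
              total (\<lambda>a b. (V a b - V' a b) + unit_mat x y a b)"
            by (rule total_mono) (use True V(2) agree \<open>y' \<noteq> y\<close> in \<open>auto simp: shift_def unit_mat_def\<close>)
          then have "excess (shift x y' y V) V' \<le> n"
            using V' by (simp add: excess_def total_add G_def)
          then have "G (shift x y' y V) V'"
            using V V' free \<open>y' \<noteq> y\<close> by (intro G_shift_left) auto
          moreover have "shift x y' y V x2 y' < V' x2 y'"
            using x2 True by (auto simp: shift_def unit_mat_def)
          ultimately show ?thesis by (auto simp: Diff_def intro!: exI[of _ V'] exI[of _ x2])
        next
          case False
          then have "G (shift x y' y V) (shift x y' y V')"
            using V V' free agree \<open>y' \<noteq> y\<close> by (intro G_shift_both) (auto simp: col_sum_def)
          moreover have "shift x y' y V x2 y' < shift x y' y V' x2 y'"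
            using x2 V(2) False \<open>y' \<noteq> y\<close> by (auto simp: shift_def unit_mat_def)
          ultimately show ?thesis
            by (auto simp: Diff_def intro!: exI[of _ "shift x y' y V'"] exI[of _ x2])
        qed
        then have "col_sum (shift x y' y V) y' = \<beta> y'" using diff_saturated by blast
        then show False using col_sum_shift[of V x y', OF V(2), of y y'] sat \<open>y' \<noteq> y\<close> by simp
      qed
    qed
    have "W \<noteq> W'" using G by (auto simp: G_def)
    then obtain y where y: "y \<in> D" by (auto simp: D_def Diff_def fun_eq_iff)
    then obtain x where "W' x y < W x y" using diff_saturated[OF G] by (auto simp: D_def)
    then have "0 < W x y" by simp
    moreover have "W \<in> partial_allocs E \<alpha> \<beta>" using G by (simp add: G_def allocs_def)
    ultimately show False using exists_free_reach_cols[of W x D] y sat by blast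
  qed
qed

end

end

section \<open>Detailed balance and convergence\<close>

context
  fixes E :: "('x::finite \<times> 'x) set"
    and \<alpha> \<beta> :: "'x \<Rightarrow> nat"
    and \<Psi> :: "'x alloc \<Rightarrow> real"
    and U :: "'x \<Rightarrow> 'x alloc \<Rightarrow> real"
    and \<M> :: "'x \<Rightarrow> 'x alloc \<Rightarrow> ('x \<Rightarrow> bool) \<Rightarrow> 'x alloc set"
    and \<nu>on \<nu>off \<nu>act :: "'x \<Rightarrow> real"
    and \<gamma> :: real
  assumes util: "utilities_of_potential (partial_allocs E \<alpha> \<beta>) \<Psi> U"
    and hall: "\<forall>A :: 'x set. A \<noteq> {} \<longrightarrow> (\<Sum>x\<in>A. \<alpha> x) < (\<Sum>y\<in>(\<Union>x\<in>A. nbrs E x). \<beta> y)"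
    and rates: "\<forall>x. \<nu>on x > 0 \<and> \<nu>off x > 0 \<and> \<nu>act x > 0"
    and adm: "admissible E \<alpha> \<beta> \<M>"
begin

abbreviation (input) "rate \<equiv> alloc_rate \<gamma> \<nu>on \<nu>off \<nu>act U \<M>"

abbreviation (input) "states \<equiv> partial_allocs E \<alpha> \<beta> \<times> (UNIV :: ('x \<Rightarrow> bool) set)"

section \<open>Positive rates and a state reachable from everywhere\<close>

lemma finite_moves: "W \<in> partial_allocs E \<alpha> \<beta> \<Longrightarrow> \<xi> z \<Longrightarrow> finite (\<M> z W \<xi>)"
  using move_row_moves[OF adm, of W \<xi> z]
  by (intro finite_subset[OF _ finite_partial_allocs[of E \<alpha> \<beta>]]) (auto simp: row_moves_def)

text \<open>The sum of the moving row cannot drop, and it already equals its upper bound.\<close>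

lemma alloc_move_closed:
  assumes W: "W \<in> allocs E \<alpha> \<beta>" and z: "\<xi> z" and W': "W' \<in> \<M> z W \<xi>"
  shows "W' \<in> allocs E \<alpha> \<beta>"
proof -
  have m: "W' \<in> row_moves E \<alpha> \<beta> z W \<xi>"
    using move_row_moves[OF adm _ z W'] W by (simp add: allocs_def)
  have "row_sum W' x = \<alpha> x" for x
  proof (cases "x = z")
    case True
    then show ?thesis
      using m W by (fastforce simp: row_moves_def allocs_def partial_allocs_def intro: antisym)
  next
    case False
    then have "row_sum W' x = row_sum W x" using m by (simp add: row_moves_def row_sum_def)
    then show ?thesis using W by (simp add: allocs_def)
  qed
  then show ?thesis using m by (simp add: allocs_def row_moves_def)
qed

lemma move_prob_nonneg: "0 \<le> move_prob \<gamma> U \<M> z W \<xi> W'"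
proof -
  have "0 \<le> part_fun \<gamma> U \<M> z W \<xi>" for W by (simp add: part_fun_def sum_nonneg)
  then show ?thesis by (simp add: move_prob_def le_max_iff_disj)
qed

text \<open>Moves never lower the total, which rules out the zero alternative of
  \<open>move_prob\<close>.\<close>

lemma move_prob_pos:
  assumes W: "W \<in> partial_allocs E \<alpha> \<beta>" and z: "\<xi> z" and W': "W' \<in> \<M> z W \<xi>"
  shows "0 < move_prob \<gamma> U \<M> z W \<xi> W'"
proof -
  have m: "W' \<in> row_moves E \<alpha> \<beta> z W \<xi>" by (rule move_row_moves[OF adm assms])
  have "row_sum W x \<le> row_sum W' x" for x
    using m by (cases "x = z") (auto simp: row_moves_def row_sum_def)
  then have "total W \<le> total W'"
    unfolding total_eq_sum_row_sum by (intro sum_mono)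
  moreover have "0 < part_fun \<gamma> U \<M> z W \<xi>"
    unfolding part_fun_def using finite_moves[of W \<xi> z] W z W' by (intro sum_pos) auto
  ultimately show ?thesis by (simp add: move_prob_def less_max_iff_disj)
qed

lemma rate_pos:
  assumes "(\<not> \<xi> z \<and> W' = W \<and> \<xi>' = \<xi>(z := True)) \<or>
    (W \<in> partial_allocs E \<alpha> \<beta> \<and> \<xi>' = \<xi> \<and> \<xi> z \<and> W' \<in> \<M> z W \<xi>)"
  shows "0 < rate (W, \<xi>) (W', \<xi>')"
  unfolding alloc_rate_def prod.case
proof (rule sum_pos2[of _ z])
  have nn: "0 \<le> \<nu>on x" "0 \<le> \<nu>off x" "0 \<le> \<nu>act x" for x
    using rates by (auto simp: less_imp_le)
  show "0 \<le> (if W' = W \<and> \<not> \<xi> x \<and> \<xi>' = \<xi>(x := True) then \<nu>on x else 0) +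
    (if W' = W \<and> \<xi> x \<and> \<xi>' = \<xi>(x := False) then \<nu>off x else 0) +
    (if \<xi>' = \<xi> \<and> \<xi> x \<and> W' \<in> \<M> x W \<xi> then \<nu>act x * move_prob \<gamma> U \<M> x W \<xi> W' else 0)" for x
    using nn move_prob_nonneg by auto
  show "0 < (if W' = W \<and> \<not> \<xi> z \<and> \<xi>' = \<xi>(z := True) then \<nu>on z else 0) +
    (if W' = W \<and> \<xi> z \<and> \<xi>' = \<xi>(z := False) then \<nu>off z else 0) +
    (if \<xi>' = \<xi> \<and> \<xi> z \<and> W' \<in> \<M> z W \<xi> then \<nu>act z * move_prob \<gamma> U \<M> z W \<xi> W' else 0)"
    using assms
  proof
    assume "\<not> \<xi> z \<and> W' = W \<and> \<xi>' = \<xi>(z := True)"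
    then show ?thesis using rates by (auto simp: fun_eq_iff)
  next
    assume a: "W \<in> partial_allocs E \<alpha> \<beta> \<and> \<xi>' = \<xi> \<and> \<xi> z \<and> W' \<in> \<M> z W \<xi>"
    then have "0 < \<nu>act z * move_prob \<gamma> U \<M> z W \<xi> W'"
      using rates move_prob_pos[of W \<xi> z W'] by simp
    then show ?thesis using a nn[of z] by (auto simp: add_nonneg_pos)
  qed
qed auto

abbreviation (input) "jumps \<equiv> {(a, b). a \<in> states \<and> b \<in> states \<and> a \<noteq> b \<and> rate a b > 0}"

lemma switch_all_on:
  assumes W: "W \<in> partial_allocs E \<alpha> \<beta>"
  shows "((W, \<xi>), (W, \<lambda>_. True)) \<in> jumps\<^sup>*"
proof (induction "card {z. \<not> \<xi> z}" arbitrary: \<xi> rule: less_induct)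
  case less
  show ?case
  proof (cases "\<exists>z. \<not> \<xi> z")
    case False
    then have "\<xi> = (\<lambda>_. True)" by auto
    then show ?thesis by simp
  next
    case True
    then obtain z where z: "\<not> \<xi> z" by blast
    let ?\<xi> = "\<xi>(z := True)"
    have "card {x. \<not> ?\<xi> x} < card {x. \<not> \<xi> x}"
      using z by (intro psubset_card_mono) auto
    then have "((W, ?\<xi>), (W, \<lambda>_. True)) \<in> jumps\<^sup>*" by (rule less)
    moreover have "((W, \<xi>), (W, ?\<xi>)) \<in> jumps"
      using rate_pos[of \<xi> z W W ?\<xi>] z W by (auto simp: fun_eq_iff)
    ultimately show ?thesis by (rule converse_rtrancl_into_rtrancl[rotated])
  qed
qed

lemma full_moves_jumps:
  assumes "(W, V) \<in> (full_moves E \<alpha> \<beta> \<M>)\<^sup>*" "W \<in> partial_allocs E \<alpha> \<beta>"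
  shows "((W, \<lambda>_. True), (V, \<lambda>_. True)) \<in> jumps\<^sup>*"
  using assms(1)
proof (induction rule: rtrancl_induct)
  case (step V V')
  then obtain z where V: "V \<in> partial_allocs E \<alpha> \<beta>" and V': "V' \<in> \<M> z V (\<lambda>_. True)"
    by (auto simp: full_moves_def[OF hall adm])
  have "V' \<in> row_moves E \<alpha> \<beta> z V (\<lambda>_. True)"
    using V V' by (intro move_row_moves[OF adm]) auto
  then have "((V, \<lambda>_. True), (V', \<lambda>_. True)) \<in> jumps"
    using rate_pos[of "\<lambda>_. True" z V' V "\<lambda>_. True"] V V' by (auto simp: row_moves_def)
  with step.IH show ?case by (rule rtrancl_into_rtrancl)
qed simp

lemma jumps_reach:
  assumes c: "c \<in> allocs E \<alpha> \<beta>" and s: "s \<in> states"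
  shows "(s, (c, \<lambda>_. True)) \<in> jumps\<^sup>*"
proof -
  obtain W \<xi> where [simp]: "s = (W, \<xi>)" and W: "W \<in> partial_allocs E \<alpha> \<beta>" using s by auto
  obtain V where V: "V \<in> allocs E \<alpha> \<beta>" "(W, V) \<in> (full_moves E \<alpha> \<beta> \<M>)\<^sup>*"
    using full_moves_reach_allocs[OF hall adm W] by blast
  have "(V, c) \<in> (alloc_moves E \<alpha> \<beta> \<M>)\<^sup>*"
    using V c by (intro alloc_moves_connected[OF hall adm])
  then have "(V, c) \<in> (full_moves E \<alpha> \<beta> \<M>)\<^sup>*"
    by (rule rtrancl_mono[THEN subsetD, rotated]) (auto simp: alloc_moves_def[OF hall adm])
  then have "(W, c) \<in> (full_moves E \<alpha> \<beta> \<M>)\<^sup>*" using V by (meson rtrancl_trans)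
  then show ?thesis
    using switch_all_on[OF W, of \<xi>] full_moves_jumps W by (auto intro: rtrancl_trans)
qed

section \<open>The stationary weight and detailed balance\<close>

definition switch_weight :: "('x \<Rightarrow> bool) \<Rightarrow> real" where
  "switch_weight \<xi> = (\<Prod>x\<in>UNIV. if \<xi> x then \<nu>on x else \<nu>off x)"

lemma switch_weight_pos: "0 < switch_weight \<xi>"
  unfolding switch_weight_def using rates by (intro prod_pos) auto

text \<open>The vertices flip independently; this is the balance of one two-state chain, the other
  factors of the product being common to both sides.\<close>

lemma switch_weight_upd:
  assumes "\<not> \<xi> z"
  shows "switch_weight (\<xi>(z := True)) * \<nu>off z = switch_weight \<xi> * \<nu>on z"
proof -
  have "(\<Prod>x\<in>UNIV - {z}. if (\<xi>(z := True)) x then \<nu>on x else \<nu>off x) =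
      (\<Prod>x\<in>UNIV - {z}. if \<xi> x then \<nu>on x else \<nu>off x)"
    by (intro prod.cong) auto
  then show ?thesis
    using assms unfolding switch_weight_def by (simp add: prod.remove[of UNIV z] mult_ac)
qed

definition stat_weight :: "'x alloc \<times> ('x \<Rightarrow> bool) \<Rightarrow> real" where
  "stat_weight = (\<lambda>(W, \<xi>). (if W \<in> allocs E \<alpha> \<beta> then exp (\<gamma> * \<Psi> W) else 0) * switch_weight \<xi>)"

text \<open>Between full allocations the totals agree, so both directions use the same maximum as
  denominator, and utility differences are potential differences. In all other cases both sides
  vanish: a partial state has weight zero, and no move leads from a full allocation back to
  it.\<close>

lemma move_balance:
  assumes W: "W \<in> partial_allocs E \<alpha> \<beta>" "W' \<in> partial_allocs E \<alpha> \<beta>"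
  shows "stat_weight (W, \<xi>) * (if \<xi> z \<and> W' \<in> \<M> z W \<xi> then \<nu>act z * move_prob \<gamma> U \<M> z W \<xi> W' else 0) =
    stat_weight (W', \<xi>) * (if \<xi> z \<and> W \<in> \<M> z W' \<xi> then \<nu>act z * move_prob \<gamma> U \<M> z W' \<xi> W else 0)"
proof (cases "W \<in> allocs E \<alpha> \<beta> \<and> W' \<in> allocs E \<alpha> \<beta> \<and> \<xi> z \<and> W' \<in> \<M> z W \<xi>")
  case True
  then have rev: "W \<in> \<M> z W' \<xi>" using move_sym[OF adm, of W W' \<xi> z] by simp
  have tot: "total W = total W'" using True by (simp add: total_eq_sum_row_sum allocs_def)
  have "W' \<in> row_moves E \<alpha> \<beta> z W \<xi>" using True W by (intro move_row_moves[OF adm]) auto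
  then have "\<forall>x y. x \<noteq> z \<longrightarrow> W' x y = W x y" by (auto simp: row_moves_def)
  then have "U z W' - U z W = \<Psi> W' - \<Psi> W"
    using util W by (simp add: utilities_of_potential_def)
  then have "\<gamma> * \<Psi> W + \<gamma> * U z W' = \<gamma> * \<Psi> W' + \<gamma> * U z W"
    unfolding distrib_left[symmetric] by (intro arg_cong[of _ _ "(*) \<gamma>"]) simp
  then have "exp (\<gamma> * \<Psi> W) * exp (\<gamma> * U z W') = exp (\<gamma> * \<Psi> W') * exp (\<gamma> * U z W)"
    by (simp add: exp_add[symmetric])
  then show ?thesis
    using True rev tot by (simp add: stat_weight_def move_prob_def max.commute mult_ac)
next
  case False
  moreover have "W \<in> \<M> z W' \<xi> \<Longrightarrow> W \<in> allocs E \<alpha> \<beta>" if "W' \<in> allocs E \<alpha> \<beta>" "\<xi> z"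
    using alloc_move_closed[of W' \<xi> z W] that by blast
  moreover have "W' \<in> \<M> z W \<xi> \<Longrightarrow> W' \<in> allocs E \<alpha> \<beta>" if "W \<in> allocs E \<alpha> \<beta>" "\<xi> z"
    using alloc_move_closed[of W \<xi> z W'] that by blast
  ultimately show ?thesis
    using move_sym[OF adm, of W W' \<xi> z] by (auto simp: stat_weight_def)
qed

lemma detailed_balance:
  assumes "a \<in> states" "b \<in> states"
  shows "stat_weight a * rate a b = stat_weight b * rate b a"
proof -
  obtain W \<xi> W' \<xi>' where ab: "a = (W, \<xi>)" "b = (W', \<xi>')" by (cases a; cases b)
  then have W: "W \<in> partial_allocs E \<alpha> \<beta>" "W' \<in> partial_allocs E \<alpha> \<beta>" using assms by auto
  \<comment> \<open>The on-summand of one direction balances the off-summand of the other. The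
    states are quantified anew because the fact is needed in both orders.\<close>
  have switch: "stat_weight (W, \<xi>) * (if W' = W \<and> \<not> \<xi> z \<and> \<xi>' = \<xi>(z := True) then \<nu>on z else 0) =
      stat_weight (W', \<xi>') * (if W = W' \<and> \<xi>' z \<and> \<xi> = \<xi>'(z := False) then \<nu>off z else 0)"
    for W \<xi> W' \<xi>' z
  proof (cases "W' = W \<and> \<not> \<xi> z \<and> \<xi>' = \<xi>(z := True)")
    case True
    then have rev: "W = W' \<and> \<xi>' z \<and> \<xi> = \<xi>'(z := False)" by (auto simp: fun_eq_iff)
    have "stat_weight (W, \<xi>) * \<nu>on z = stat_weight (W', \<xi>') * \<nu>off z"
      using True switch_weight_upd[of \<xi> z] by (simp add: stat_weight_def)
    then show ?thesis unfolding if_P[OF True] if_P[OF rev] .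
  next
    case False
    moreover have "\<not> (W = W' \<and> \<xi>' z \<and> \<xi> = \<xi>'(z := False))"
    proof
      assume rev: "W = W' \<and> \<xi>' z \<and> \<xi> = \<xi>'(z := False)"
      then have "\<xi>(z := True) = \<xi>'" by (metis (full_types) fun_upd_triv fun_upd_upd)
      moreover have "\<not> \<xi> z" using rev by (metis fun_upd_same)
      ultimately show False using rev False by blast
    qed
    ultimately show ?thesis by (simp only: if_False mult_zero_right)
  qed
  have move: "stat_weight (W, \<xi>) * (if \<xi>' = \<xi> \<and> \<xi> z \<and> W' \<in> \<M> z W \<xi> then \<nu>act z * move_prob \<gamma> U \<M> z W \<xi> W' else 0) =
    stat_weight (W', \<xi>') * (if \<xi> = \<xi>' \<and> \<xi>' z \<and> W \<in> \<M> z W' \<xi>' then \<nu>act z * move_prob \<gamma> U \<M> z W' \<xi>' W else 0)" for z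
    using move_balance[OF W, of \<xi> z] by (cases "\<xi>' = \<xi>") simp_all
  show ?thesis
    unfolding ab alloc_rate_def prod.case sum_distrib_left distrib_left
    by (intro sum.cong refl)
      (use switch[of W \<xi> W' _ \<xi>'] switch[of W' \<xi>' W _ \<xi>] move in \<open>simp only: add.commute\<close>)
qed

section \<open>Convergence in law of the allocation component\<close>

lemma allocation_converges:
  assumes X: "ctmc \<Omega> states rate X"
  shows "weak_conv_discrete (\<lambda>t. distr \<Omega> (count_space UNIV) (\<lambda>\<omega>. fst (X t \<omega>)))
    (gibbs (allocs E \<alpha> \<beta>) \<Psi> \<gamma>) at_top"
  unfolding weak_conv_discrete_def
proof (intro allI impI)
  fix f :: "'x alloc \<Rightarrow> real"
  define Z where "Z = (\<Sum>W\<in>allocs E \<alpha> \<beta>. exp (\<gamma> * \<Psi> W))"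
  define C where "C = (\<Sum>\<xi>\<in>UNIV. switch_weight \<xi>)"
  have Z: "Z > 0" unfolding Z_def by (intro sum_exp_pos finite_allocs allocs_nonempty[OF hall adm])
  have C: "C > 0" unfolding C_def using switch_weight_pos by (intro sum_pos) auto
  define \<pi> where "\<pi> s = stat_weight s / (Z * C)" for s
  \<comment> \<open>The weight is a product, so summing over the functional state yields the factor
    \<open>C\<close>, which the normalization cancels.\<close>
  have marginal: "(\<Sum>s\<in>states. h (fst s) * \<pi> s) = (\<Sum>W\<in>allocs E \<alpha> \<beta>. exp (\<gamma> * \<Psi> W) * h W) / Z" for h
  proof -
    have "(\<Sum>s\<in>states. h (fst s) * \<pi> s) =
        (\<Sum>W\<in>partial_allocs E \<alpha> \<beta>. \<Sum>\<xi>\<in>UNIV. h W * \<pi> (W, \<xi>))"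
      by (simp add: sum.cartesian_product case_prod_beta)
    also have "\<dots> = (\<Sum>W\<in>partial_allocs E \<alpha> \<beta>. if W \<in> allocs E \<alpha> \<beta> then exp (\<gamma> * \<Psi> W) * h W / Z else 0)"
    proof (intro sum.cong refl)
      fix W
      have "(\<Sum>\<xi>\<in>UNIV. h W * \<pi> (W, \<xi>)) =
          (\<Sum>\<xi>\<in>UNIV. h W * (if W \<in> allocs E \<alpha> \<beta> then exp (\<gamma> * \<Psi> W) else 0) / (Z * C) * switch_weight \<xi>)"
        by (simp add: \<pi>_def stat_weight_def mult_ac)
      also have "\<dots> = h W * (if W \<in> allocs E \<alpha> \<beta> then exp (\<gamma> * \<Psi> W) else 0) / (Z * C) * C"
        unfolding C_def by (rule sum_distrib_left[symmetric])
      finally show "(\<Sum>\<xi>\<in>UNIV. h W * \<pi> (W, \<xi>)) =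
          (if W \<in> allocs E \<alpha> \<beta> then exp (\<gamma> * \<Psi> W) * h W / Z else 0)"
        using C by (simp add: mult_ac)
    qed
    also have "\<dots> = (\<Sum>W\<in>allocs E \<alpha> \<beta>. exp (\<gamma> * \<Psi> W) * h W / Z)"
      using allocs_partial finite_partial_allocs
      by (intro sum.mono_neutral_cong_right) auto
    finally show ?thesis by (simp add: sum_divide_distrib)
  qed
  obtain c where c: "c \<in> allocs E \<alpha> \<beta>" using allocs_nonempty[OF hall adm] by blast
  have "((\<lambda>t. \<integral>\<omega>. f (fst (X t \<omega>)) \<partial>\<Omega>) \<longlongrightarrow> (\<Sum>s\<in>states. f (fst s) * \<pi> s)) at_top"
  proof (rule ctmc_expectation_tendsto[OF X])
    show "\<pi> i * rate i j = \<pi> j * rate j i" if "i \<in> states" "j \<in> states" for i j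
      using detailed_balance[OF that] by (simp add: \<pi>_def)
    show "(\<Sum>s\<in>states. \<pi> s) = 1"
      using marginal[of "\<lambda>_. 1"] Z by (simp add: Z_def)
    show "(c, \<lambda>_. True) \<in> states" using c allocs_partial by auto
    show "(i, (c, \<lambda>_. True)) \<in> jumps\<^sup>*" if "i \<in> states" for i
      using c that by (rule jumps_reach)
  qed
  \<comment> \<open>Measurability of \<open>X t\<close> is known for t \<ge> 0 only, so the change
    of variables holds eventually.\<close>
  moreover have "\<forall>\<^sub>F t in at_top. (\<integral>\<omega>. f (fst (X t \<omega>)) \<partial>\<Omega>) =
      (\<integral>W. f W \<partial>distr \<Omega> (count_space UNIV) (\<lambda>\<omega>. fst (X t \<omega>)))"
    using eventually_ge_at_top[of 0]
  proof eventually_elim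
    case (elim t)
    have "X t \<in> measurable \<Omega> (count_space states)" using X elim by (simp add: ctmc_def)
    then have "(\<lambda>\<omega>. fst (X t \<omega>)) \<in> measurable \<Omega> (count_space UNIV)"
      by (rule measurable_compose) simp
    then show ?case by (subst integral_distr) auto
  qed
  ultimately have "((\<lambda>t. \<integral>W. f W \<partial>distr \<Omega> (count_space UNIV) (\<lambda>\<omega>. fst (X t \<omega>))) \<longlongrightarrow>
      (\<Sum>s\<in>states. f (fst s) * \<pi> s)) at_top"
    by (rule Lim_transform_eventually)
  then show "((\<lambda>t. \<integral>W. f W \<partial>distr \<Omega> (count_space UNIV) (\<lambda>\<omega>. fst (X t \<omega>))) \<longlongrightarrow>
      (\<integral>W. f W \<partial>gibbs (allocs E \<alpha> \<beta>) \<Psi> \<gamma>)) at_top"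
    by (simp add: marginal integral_gibbs[OF finite_allocs] Z_def)
qed

end

theorem mainTheorem4:
  fixes E :: "('x::finite \<times> 'x) set"
    and \<alpha> \<beta> :: "'x \<Rightarrow> nat"
    and f g :: "'x \<Rightarrow> ('x \<Rightarrow> nat) \<Rightarrow> real"
    and \<Psi> :: "'x alloc \<Rightarrow> real"
    and U :: "'x \<Rightarrow> 'x alloc \<Rightarrow> real"
    and \<M> :: "'x \<Rightarrow> 'x alloc \<Rightarrow> ('x \<Rightarrow> bool) \<Rightarrow> 'x alloc set"
    and \<nu>on \<nu>off \<nu>act :: "'x \<Rightarrow> real"
  assumes "\<forall>W \<in> partial_allocs E \<alpha> \<beta>. \<Psi> W = potential f g W"
    and "utilities_of_potential (partial_allocs E \<alpha> \<beta>) \<Psi> U"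
    and "\<forall>A :: 'x set. A \<noteq> {} \<longrightarrow> (\<Sum>x\<in>A. \<alpha> x) < (\<Sum>y\<in>(\<Union>x\<in>A. nbrs E x). \<beta> y)"
    and "\<forall>x. \<nu>on x > 0 \<and> \<nu>off x > 0 \<and> \<nu>act x > 0"
    and "admissible E \<alpha> \<beta> \<M>"
  shows "(\<forall>\<gamma>>0. prob_space (gibbs (allocs E \<alpha> \<beta>) \<Psi> \<gamma>) \<and>
            (\<forall>(\<Omega> :: 'w measure) X.
               ctmc \<Omega> (partial_allocs E \<alpha> \<beta> \<times> UNIV) (alloc_rate \<gamma> \<nu>on \<nu>off \<nu>act U \<M>) X \<longrightarrow>
               weak_conv_discrete (\<lambda>t. distr \<Omega> (count_space UNIV) (\<lambda>\<omega>. fst (X t \<omega>)))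
                 (gibbs (allocs E \<alpha> \<beta>) \<Psi> \<gamma>) at_top)) \<and>
         (\<exists>\<mu>. prob_space \<mu> \<and> sets \<mu> = UNIV \<and>
            (AE W in \<mu>. is_arg_max \<Psi> (\<lambda>W. W \<in> allocs E \<alpha> \<beta>) W) \<and>
            weak_conv_discrete (gibbs (allocs E \<alpha> \<beta>) \<Psi>) \<mu> at_top)"
proof (intro conjI allI impI)
  fix \<gamma> :: real
  show "prob_space (gibbs (allocs E \<alpha> \<beta>) \<Psi> \<gamma>)"
    by (rule prob_space_gibbs[OF finite_allocs allocs_nonempty[OF assms(3,5)]])
  show "weak_conv_discrete (\<lambda>t. distr \<Omega> (count_space UNIV) (\<lambda>\<omega>. fst (X t \<omega>)))
      (gibbs (allocs E \<alpha> \<beta>) \<Psi> \<gamma>) at_top"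
    if "ctmc \<Omega> (partial_allocs E \<alpha> \<beta> \<times> UNIV) (alloc_rate \<gamma> \<nu>on \<nu>off \<nu>act U \<M>) X"
    for \<Omega> :: "'w measure" and X
    using assms(2-5) that by (rule allocation_converges)
next
  \<comment> \<open>The limit measure is the uniform distribution on \<open>?B\<close>, namely
    \<open>gibbs ?B \<Psi> 0\<close>.\<close>
  let ?B = "{W. is_arg_max \<Psi> (\<lambda>W. W \<in> allocs E \<alpha> \<beta>) W}"
  note argmax = gibbs_tendsto_argmax[OF finite_allocs allocs_nonempty[OF assms(3,5)], of \<Psi>]
  have "AE W in gibbs ?B \<Psi> 0. is_arg_max \<Psi> (\<lambda>W. W \<in> allocs E \<alpha> \<beta>) W"
    using AE_gibbs[of ?B \<Psi> 0] by simp
  moreover have "sets (gibbs ?B \<Psi> 0) = UNIV" by (simp add: gibbs_def)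
  ultimately show "\<exists>\<mu>. prob_space \<mu> \<and> sets \<mu> = UNIV \<and>
      (AE W in \<mu>. is_arg_max \<Psi> (\<lambda>W. W \<in> allocs E \<alpha> \<beta>) W) \<and>
      weak_conv_discrete (gibbs (allocs E \<alpha> \<beta>) \<Psi>) \<mu> at_top"
    using argmax prob_space_gibbs[OF argmax(1,2), of \<Psi> 0] by blast
qed

end
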